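(* Let $\rho=11$. There exists a positive numerical constant $c$ such that for every nonzero real number $\lambda$ and every $r\in[0,1[$, $$\sup_{(l,m)\in\widehat{K}_0}|\Phi_{\lambda,lm}(r)|\le c\left(1+|\lambda|+\frac{1}{|\lambda|}\right)(1-r^2)^{\frac{\rho}{2}} .$$
   Context: $\widehat{K}_0$ is the set of pairs $(l,m)$ of nonnegative integers with $l\ge m\ge0$ and $l\pm m$ even. For $(l,m)\in\widehat{K}_0$, $\Phi_{\lambda,lm}$ is the generalized spherical function of the octonionic hyperbolic plane: $$\Phi_{\lambda,lm}(r)=\frac{\left(\frac{i\lambda+\rho}{2}\right)_{\frac{m+l}{2}}\left(\frac{i\lambda+\rho}{2}-3\right)_{\frac{l-m}{2}}}{(8)_l}\,r^l(1-r^2)^{\frac{i\lambda+\rho}{2}}\,{}_2F_1\!\left(\frac{i\lambda+\rho+l+m}{2},\frac{i\lambda+\rho+l-m}{2}-3,l+8;r^2\right),$$ where $(a)_k=a(a+1)\cdots(a+k-1)$ is the Pochhammer symbol and ${}_2F_1(a,b,c;x)$ is the Gauss hypergeometric function. "Numerical constant" means independent of $\lambda$, $r$, $l$, $m$. *)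

theory Defs
  imports "HOL-Analysis.Analysis"
begin

definition rho :: real where
  "rho = 11"

definition K0_hat :: "(nat \<times> nat) set" where
  "K0_hat = {(l, m). m \<le> l \<and> even (l + m) \<and> even (l - m)}"

(* The Gauss series; only used for norm z < 1 and c not a nonpositive integer. *)
definition hypergeo_2F1 :: "complex \<Rightarrow> complex \<Rightarrow> complex \<Rightarrow> complex \<Rightarrow> complex" where
  "hypergeo_2F1 a b c z = eval_fps (fps_hypergeo [a, b] [c] 1) z"

(* Confirms that the coefficients of the library's series, whose last argument scales
   the variable, are the usual ones. *)
lemma hypergeo_2F1_eq_suminf:
  "hypergeo_2F1 a b c z =
     (\<Sum>n. pochhammer a n * pochhammer b n / (pochhammer c n * fact n) * z ^ n)"
  by (simp add: hypergeo_2F1_def eval_fps_def fps_hypergeo_nth)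

(* Natural-number subtraction and division are exact for (l, m) in K0_hat.  For 0 <= r < 1
   the base of powr is a positive real, so its principal value is the usual power. *)
definition Phi :: "complex \<Rightarrow> nat \<Rightarrow> nat \<Rightarrow> real \<Rightarrow> complex" where
  "Phi lam l m r =
     pochhammer ((\<i> * lam + of_real rho) / 2) ((m + l) div 2)
     * pochhammer ((\<i> * lam + of_real rho) / 2 - 3) ((l - m) div 2)
     / pochhammer 8 l
     * of_real r ^ l
     * of_real (1 - r\<^sup>2) powr ((\<i> * lam + of_real rho) / 2)
     * hypergeo_2F1 ((\<i> * lam + of_real rho + of_nat l + of_nat m) / 2)
                    ((\<i> * lam + of_real rho + of_nat l - of_nat m) / 2 - 3)
                    (of_nat l + 8) (of_real (r\<^sup>2))"

end

theory Submission
  imports Defs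
begin

text \<open>
  Put \<open>s = (i lam + rho) / 2\<close>. After the factor of modulus \<open>(1 - r\<^sup>2) powr (rho / 2)\<close> is removed, a
  hypergeometric function of \<open>r\<^sup>2\<close> with \<open>a + b - c = i lam\<close> remains, which is exactly the borderline
  case where it neither converges nor blows up at \<open>r = 1\<close> but oscillates. Summing absolute values of
  its terms loses a factor that is exponential in \<open>lam\<close>, so the oscillation must be used, uniformly in
  \<open>l\<close> and \<open>m\<close>.

  This is done by an energy argument. With \<open>r = tanh x\<close>, multiplication by a power of \<open>tanh x\<close> and a
  phase turns the function into a solution \<open>w\<close> of \<open>w'' = (V - lam\<^sup>2) w\<close>, where the potential \<open>V\<close>
  contains \<open>l\<close> and \<open>m\<close> but is positive and satisfies \<open>V' \<le> - 2 V\<close>. For such potentials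
  (\<open>norm_le_of_repulsive_schroedinger\<close>) the energy increases with \<open>x\<close>, so the energy \<open>M\<^sup>2\<close> at
  infinity bounds \<open>w\<close> by \<open>(1 + sqrt 2 / |lam|) M\<close> everywhere, whatever the size of \<open>V\<close>.

  The energy at infinity follows from the asymptotics of the Taylor coefficients
  (\<open>hypergeo_deriv_boundary\<close>): \<open>M = 2 |Gamma c Gamma (1 + i lam) / (Gamma a Gamma b)|\<close>. Multiplied by
  the Pochhammer prefactor of the spherical function this becomes independent of \<open>l\<close> and \<open>m\<close>
  (\<open>Gamma_pochhammer_quotient\<close>), and the reflection formula shows that it decays like
  \<open>(1 + |lam|) powr (-13/2)\<close> (\<open>norm_c_function_le\<close>).

  Since \<open>|w|\<close> contains an additional factor \<open>r powr (15/2)\<close>, this settles the range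
  \<open>r \<ge> 1 / (2 |s|)\<close>, where dividing by that factor costs at most a constant times
  \<open>(1 + |lam|) powr (15/2)\<close>. For smaller \<open>r\<close> the power series is dominated by a geometric series,
  uniformly in all parameters (\<open>hypergeo_small_bound\<close>).
\<close>

section \<open>Waves in a repulsive potential\<close>

text \<open>
  A wave in a repulsive potential is controlled by its asymptotic energy. Along a solution of
  \<open>w'' = (V - lam\<^sup>2) w\<close> the quantity \<open>|w'|\<^sup>2 + (lam\<^sup>2 - V) |w|\<^sup>2\<close> has derivative \<open>- V' |w|\<^sup>2 \<ge> 0\<close>, so
  it is bounded by its limit at infinity. This limit is read off from the single quantity
  \<open>|w' + i lam w|\<^sup>2\<close>, because the cross term is a Wronskian of \<open>w\<close> and its conjugate, which is
  constant and vanishes at the origin.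

  The energy bounds \<open>w\<close> directly where \<open>V \<le> lam\<^sup>2 / 2\<close>. In the band
  \<open>lam\<^sup>2 / 2 < V \<le> lam\<^sup>2\<close> it still bounds \<open>w'\<close>, and \<open>V' \<le> - 2 V\<close> makes the band shorter than 1, so
  \<open>w\<close> changes by at most \<open>M\<close> there. In the forbidden region \<open>V > lam\<^sup>2\<close> the function \<open>|w|\<^sup>2\<close> is
  convex and starts with slope 0, hence increases up to the turning point. The bound
  is therefore uniform over all such potentials.
\<close>

lemma norm_le_of_repulsive_schroedinger:
  fixes w w1 :: "real \<Rightarrow> complex" and V V' :: "real \<Rightarrow> real" and lam M :: real
  assumes lam: "lam \<noteq> 0"
    and w: "\<And>x. x > 0 \<Longrightarrow> (w has_vector_derivative w1 x) (at x)"
    and w1: "\<And>x. x > 0 \<Longrightarrow> (w1 has_vector_derivative of_real (V x - lam\<^sup>2) * w x) (at x)"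
    and V: "\<And>x. x > 0 \<Longrightarrow> (V has_real_derivative V' x) (at x)"
    and V_pos: "\<And>x. x > 0 \<Longrightarrow> V x \<ge> 0"
    and V_decay: "\<And>x. x > 0 \<Longrightarrow> V' x \<le> - 2 * V x"
    and regular: "((\<lambda>x. w1 x * cnj (w x)) \<longlongrightarrow> 0) (at_right 0)"
    and outgoing: "((\<lambda>x. norm (w1 x + \<i> * of_real lam * w x)) \<longlongrightarrow> M) at_top"
    and x: "x > 0"
  shows "norm (w x) \<le> (1 + sqrt 2 / \<bar>lam\<bar>) * M"
proof -
  define P R I J where "P = (\<lambda>x. (norm (w x))\<^sup>2)" and "R = (\<lambda>x. (norm (w1 x))\<^sup>2)"
    and "I = (\<lambda>x. Re (w1 x * cnj (w x)))" and "J = (\<lambda>x. Im (w1 x * cnj (w x)))"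
  have dRe: "((\<lambda>x. Re (w x)) has_real_derivative Re (w1 x)) (at x)"
    and dIm: "((\<lambda>x. Im (w x)) has_real_derivative Im (w1 x)) (at x)"
    and dRe1: "((\<lambda>x. Re (w1 x)) has_real_derivative (V x - lam\<^sup>2) * Re (w x)) (at x)"
    and dIm1: "((\<lambda>x. Im (w1 x)) has_real_derivative (V x - lam\<^sup>2) * Im (w x)) (at x)"
    if "x > 0" for x
    using bounded_linear.has_vector_derivative[OF bounded_linear_Re w[OF that]]
      bounded_linear.has_vector_derivative[OF bounded_linear_Im w[OF that]]
      bounded_linear.has_vector_derivative[OF bounded_linear_Re w1[OF that]]
      bounded_linear.has_vector_derivative[OF bounded_linear_Im w1[OF that]]
    by (simp_all add: has_real_derivative_iff_has_vector_derivative)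
  define u v u1 v1 where "u = (\<lambda>x. Re (w x))" and "v = (\<lambda>x. Im (w x))"
    and "u1 = (\<lambda>x. Re (w1 x))" and "v1 = (\<lambda>x. Im (w1 x))"
  note uv = u_def v_def u1_def v1_def
  have P_eq: "P = (\<lambda>x. (u x)\<^sup>2 + (v x)\<^sup>2)" and R_eq: "R = (\<lambda>x. (u1 x)\<^sup>2 + (v1 x)\<^sup>2)"
    and I_eq: "I = (\<lambda>x. u1 x * u x + v1 x * v x)"
    and J_eq: "J = (\<lambda>x. v1 x * u x - u1 x * v x)"
    by (auto simp: P_def R_def I_def J_def cmod_power2 uv)
  have dP: "(P has_real_derivative 2 * I x) (at x)"
    and dR: "(R has_real_derivative 2 * (V x - lam\<^sup>2) * I x) (at x)"
    and dI: "(I has_real_derivative R x + (V x - lam\<^sup>2) * P x) (at x)"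
    and dJ: "(J has_real_derivative 0) (at x)" if "x > 0" for x
  proof -
    have d: "(u has_real_derivative u1 x) (at x)" "(v has_real_derivative v1 x) (at x)"
      "(u1 has_real_derivative (V x - lam\<^sup>2) * u x) (at x)"
      "(v1 has_real_derivative (V x - lam\<^sup>2) * v x) (at x)"
      using dRe[OF that] dIm[OF that] dRe1[OF that] dIm1[OF that] by (simp_all add: uv)
    show "(P has_real_derivative 2 * I x) (at x)"
      unfolding P_eq I_eq by (auto intro!: derivative_eq_intros d simp: algebra_simps)
    show "(R has_real_derivative 2 * (V x - lam\<^sup>2) * I x) (at x)"
      unfolding R_eq I_eq by (auto intro!: derivative_eq_intros d simp: algebra_simps)
    show "(I has_real_derivative R x + (V x - lam\<^sup>2) * P x) (at x)"
      unfolding R_eq I_eq P_eq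
      by (auto intro!: derivative_eq_intros d simp: algebra_simps power2_eq_square)
    show "(J has_real_derivative 0) (at x)"
      unfolding J_eq by (auto intro!: derivative_eq_intros d simp: algebra_simps)
  qed
  \<comment> \<open>The Wronskian of w and its conjugate vanishes.\<close>
  have J0: "J x = 0" if x: "x > 0" for x
  proof -
    have "J y = J x" if "0 < y" "y < x" for y
    proof (rule antisym)
      show "J y \<le> J x" by (rule DERIV_nonneg_imp_nondecreasing) (use that in \<open>auto intro!: exI[of _ 0] dJ\<close>)
      show "J x \<le> J y" by (rule DERIV_nonpos_imp_nonincreasing) (use that in \<open>auto intro!: exI[of _ 0] dJ\<close>)
    qed
    then have "\<forall>\<^sub>F y in at_right 0. J y = J x"
      using x unfolding eventually_at_right_field by blast
    then have "(J \<longlongrightarrow> J x) (at_right 0)" by (rule tendsto_eventually)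
    moreover have "(J \<longlongrightarrow> 0) (at_right 0)"
      using tendsto_Im[OF regular] by (simp add: J_def)
    ultimately show ?thesis using tendsto_unique trivial_limit_at_right_real by blast
  qed
  have V_exp: "V y \<le> exp (- 2 * (y - x)) * V x" if xy: "0 < x" "x \<le> y" for x y
  proof -
    have "exp (2 * y) * V y \<le> exp (2 * x) * V x"
    proof (rule DERIV_nonpos_imp_nonincreasing[OF xy(2)])
      fix z assume "x \<le> z" "z \<le> y"
      then have z: "z > 0" using xy by simp
      have "((\<lambda>z. exp (2 * z) * V z) has_real_derivative exp (2 * z) * (2 * V z + V' z)) (at z)"
        by (auto intro!: derivative_eq_intros V[OF z] simp: algebra_simps)
      moreover have "exp (2 * z) * (2 * V z + V' z) \<le> 0"
        using V_decay[OF z] by (intro mult_nonneg_nonpos) auto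
      ultimately show "\<exists>d. ((\<lambda>z. exp (2 * z) * V z) has_real_derivative d) (at z) \<and> d \<le> 0"
        by blast
    qed
    then have "exp (- 2 * y) * (exp (2 * y) * V y) \<le> exp (- 2 * y) * (exp (2 * x) * V x)"
      by (intro mult_left_mono) auto
    moreover have "exp (- 2 * y) * (exp (2 * y) * V y) = V y"
      by (simp add: exp_minus)
    moreover have "exp (- 2 * y) * (exp (2 * x) * V x) = exp (- 2 * (y - x)) * V x"
      by (simp add: exp_minus exp_diff field_simps right_diff_distrib)
    ultimately show ?thesis by linarith
  qed
  have V_anti: "V y \<le> V x" if "0 < x" "x \<le> y" for x y
  proof -
    have "exp (- 2 * (y - x)) * V x \<le> 1 * V x"
      using that V_pos[of x] by (intro mult_right_mono) auto
    then show ?thesis using V_exp[OF that] by simp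
  qed
  have out_sq: "(norm (w1 x + \<i> * of_real lam * w x))\<^sup>2 = R x + lam\<^sup>2 * P x" if "x > 0" for x
  proof -
    have "(norm (w1 x + \<i> * of_real lam * w x))\<^sup>2 = R x + lam\<^sup>2 * P x + 2 * lam * J x"
      by (simp add: P_eq R_eq J_eq cmod_power2 uv) (simp add: algebra_simps power2_eq_square)
    then show ?thesis using J0[OF that] by simp
  qed
  have M0: "M \<ge> 0" by (rule tendsto_lowerbound[OF outgoing]) auto
  have energy: "R x + (lam\<^sup>2 - V x) * P x \<le> M\<^sup>2" if x: "x > 0" for x
  proof (rule tendsto_lowerbound)
    show "((\<lambda>y. (norm (w1 y + \<i> * of_real lam * w y))\<^sup>2) \<longlongrightarrow> M\<^sup>2) at_top"
      by (intro tendsto_intros outgoing)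
    show "\<forall>\<^sub>F y in at_top. R x + (lam\<^sup>2 - V x) * P x \<le> (norm (w1 y + \<i> * of_real lam * w y))\<^sup>2"
      using eventually_ge_at_top[of x]
    proof eventually_elim
      case (elim y)
      have "R x + (lam\<^sup>2 - V x) * P x \<le> R y + (lam\<^sup>2 - V y) * P y"
      proof (rule DERIV_nonneg_imp_nondecreasing[OF elim])
        fix z assume "x \<le> z" "z \<le> y"
        then have z: "z > 0" using x by simp
        have "((\<lambda>z. R z + (lam\<^sup>2 - V z) * P z) has_real_derivative - V' z * P z) (at z)"
          by (auto intro!: derivative_eq_intros V[OF z] dR[OF z] dP[OF z] simp: algebra_simps)
        moreover have "- V' z * P z \<ge> 0"
          using V_decay[OF z] V_pos[OF z] by (intro mult_nonneg_nonneg) (auto simp: P_def)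
        ultimately show "\<exists>d. ((\<lambda>z. R z + (lam\<^sup>2 - V z) * P z) has_real_derivative d) (at z) \<and> d \<ge> 0"
          by blast
      qed
      also have "\<dots> \<le> R y + lam\<^sup>2 * P y"
        using V_pos[of y] x elim by (simp add: P_def algebra_simps)
      finally show ?case using out_sq[of y] x elim by simp
    qed
  qed simp
  have speed: "norm (w1 x) \<le> M" if x: "x > 0" "V x \<le> lam\<^sup>2" for x
  proof (rule power2_le_imp_le[OF _ M0])
    have "(lam\<^sup>2 - V x) * P x \<ge> 0" using x by (simp add: P_def)
    then show "(norm (w1 x))\<^sup>2 \<le> M\<^sup>2" using energy[OF x(1)] by (simp add: R_def)
  qed
  have far: "norm (w x) \<le> sqrt 2 / \<bar>lam\<bar> * M" if x: "x > 0" "V x \<le> lam\<^sup>2 / 2" for x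
  proof (rule power2_le_imp_le)
    have "lam\<^sup>2 / 2 * P x \<le> (lam\<^sup>2 - V x) * P x"
      using x by (intro mult_right_mono) (auto simp: P_def)
    also have "\<dots> \<le> M\<^sup>2" using energy[OF x(1)] by (simp add: R_def) (smt (verit) zero_le_power2)
    finally show "(norm (w x))\<^sup>2 \<le> (sqrt 2 / \<bar>lam\<bar> * M)\<^sup>2"
      using lam by (simp add: P_def power_mult_distrib power_divide field_simps)
  qed (use M0 in auto)
  have exp2: "exp (- 2 :: real) \<le> 1 / 2"
    using exp_ge_add_one_self[of 2] by (simp add: exp_minus field_simps)
  have allowed: "norm (w x) \<le> (1 + sqrt 2 / \<bar>lam\<bar>) * M" if x: "x > 0" "V x \<le> lam\<^sup>2" for x
  proof -
    have "V (x + 1) \<le> exp (- 2) * V x" using V_exp[of x "x + 1"] x by simp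
    also have "\<dots> \<le> 1 / 2 * lam\<^sup>2"
      using exp2 x V_pos[of x] by (intro mult_mono) auto
    finally have end_pt: "norm (w (x + 1)) \<le> sqrt 2 / \<bar>lam\<bar> * M" using far[of "x + 1"] x by simp
    have "\<exists>z\<in>{x<..<x + 1}. norm (w (x + 1) - w x) \<le> norm ((x + 1 - x) *\<^sub>R w1 z)"
    proof (rule mvt_general)
      show "continuous_on {x..x + 1} w"
        using x has_vector_derivative_continuous[OF w] by (intro continuous_at_imp_continuous_on) auto
      show "(w has_derivative (\<lambda>h. h *\<^sub>R w1 z)) (at z)" if "x < z" "z < x + 1" for z
        using w[of z] x that by (simp add: has_vector_derivative_def)
    qed simp
    then obtain z where "x < z" "norm (w (x + 1) - w x) \<le> norm (w1 z)" by auto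
    then have "norm (w (x + 1) - w x) \<le> M"
      using speed[of z] V_anti[of x z] x by simp
    then have "norm (w x) \<le> norm (w (x + 1)) + M"
      using norm_triangle_ineq2[of "w x" "w (x + 1)"] by (simp add: norm_minus_commute)
    then show ?thesis using end_pt by (simp add: algebra_simps)
  qed
  show ?thesis
  proof (cases "V x \<le> lam\<^sup>2")
    case True
    then show ?thesis using allowed x by blast
  next
    case False
    \<comment> \<open>By the decay of V, the turning point lies at distance at most k, where the decay estimate
      brings the value V x down to exactly the energy level.\<close>
    define k where "k = ln (V x / lam\<^sup>2) / 2"
    have Vx: "lam\<^sup>2 > 0" "V x > lam\<^sup>2" using False lam by auto
    then have Vx0: "V x \<noteq> 0" by linarith
    from Vx have ratio: "V x / lam\<^sup>2 > 1" by (simp add: field_simps)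
    have k: "k > 0" unfolding k_def using ln_gt_zero[OF ratio] by simp
    have "exp (- 2 * k) = inverse (exp (ln (V x / lam\<^sup>2)))" unfolding k_def by (simp add: exp_minus)
    also have "exp (ln (V x / lam\<^sup>2)) = V x / lam\<^sup>2" using ratio by (intro exp_ln) linarith
    finally have "exp (- 2 * k) * V x = lam\<^sup>2" using Vx Vx0 by (simp add: field_simps)
    then have "V (x + k) \<le> lam\<^sup>2" using V_exp[of x "x + k"] k x by simp
    then have "\<exists>X\<ge>x. X \<le> x + k \<and> V X = lam\<^sup>2"
    proof (intro IVT2 allI impI)
      show "isCont V z" if "x \<le> z \<and> z \<le> x + k" for z
        using V[of z] that x DERIV_isCont by auto
    qed (use False k in auto)
    then obtain X where X: "x \<le> X" "V X = lam\<^sup>2" by blast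
    have I_nonneg: "I z \<ge> 0" if z: "0 < z" "z \<le> X" for z
    proof (rule tendsto_upperbound)
      show "(I \<longlongrightarrow> 0) (at_right 0)" using tendsto_Re[OF regular] by (simp add: I_def)
      have "I y \<le> I z" if y: "0 < y" "y < z" for y
      proof (rule DERIV_nonneg_imp_nondecreasing[of y z I])
        fix v assume "y \<le> v" "v \<le> z"
        then have v: "v > 0" "V v \<ge> lam\<^sup>2" using y z X V_anti[of v X] by auto
        then have "R v + (V v - lam\<^sup>2) * P v \<ge> 0" by (simp add: R_def P_def)
        then show "\<exists>d. (I has_real_derivative d) (at v) \<and> d \<ge> 0" using dI[OF v(1)] by blast
      qed (use y in simp)
      then show "\<forall>\<^sub>F y in at_right 0. I y \<le> I z"
        using z unfolding eventually_at_right_field by blast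
    qed simp
    have "P x \<le> P X"
    proof (rule DERIV_nonneg_imp_nondecreasing[OF X(1)])
      fix z assume "x \<le> z" "z \<le> X"
      then show "\<exists>d. (P has_real_derivative d) (at z) \<and> d \<ge> 0"
        using x I_nonneg[of z] dP[of z] by (intro exI[of _ "2 * I z"]) auto
    qed
    then have "norm (w x) \<le> norm (w X)" by (simp add: P_def)
    then show ?thesis using allowed[of X] x X by simp
  qed
qed

section \<open>Boundary behaviour of the hypergeometric series\<close>

text \<open>
  Euler's limit formula for the reciprocal Gamma function, with the power shifted so that it can be
  divided and multiplied termwise in the coefficients of a hypergeometric series.
\<close>

lemma pochhammer_asymp:
  fixes z :: complex
  shows "(\<lambda>n. pochhammer z n / (fact n * of_nat n powr (z - 1))) \<longlonglongrightarrow> rGamma z"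
proof -
  have "(\<lambda>n. 1 / (1 + z * inverse (of_nat n))) \<longlonglongrightarrow> 1 / (1 + z * 0)"
    by (intro tendsto_intros lim_inverse_n) auto
  then have "(\<lambda>n. rGamma_series z n * (1 / (1 + z * inverse (of_nat n)))) \<longlonglongrightarrow> rGamma z * 1"
    by (intro tendsto_mult tendsto_intros) simp
  moreover have "\<forall>\<^sub>F n in sequentially. rGamma_series z n * (1 / (1 + z * inverse (of_nat n)))
      = pochhammer z n / (fact n * of_nat n powr (z - 1))"
    using eventually_gt_at_top[of "nat \<lceil>norm z\<rceil>"]
  proof eventually_elim
    case (elim n)
    then have "real n > norm z" by linarith
    then have n: "z + of_nat n \<noteq> 0" "n > 0"
      by (metis add.commute add_eq_0_iff2 less_irrefl norm_minus_cancel norm_of_nat,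
          metis gr0I norm_not_less_zero of_nat_0)
    have "rGamma_series z n = pochhammer z n * (z + of_nat n) / (fact n * of_nat n powr z)"
      using n by (simp add: rGamma_series_def pochhammer_Suc powr_def Ln_of_nat mult.commute)
    moreover have "of_nat n powr (z - 1) = of_nat n powr z / of_nat n"
      using n by (simp add: powr_diff)
    moreover have "1 / (1 + z * inverse (of_nat n)) = of_nat n / (z + of_nat n)"
      using n by (simp add: field_simps)
    ultimately show ?case using n by simp
  qed
  ultimately show ?thesis by (simp add: tendsto_cong)
qed

text \<open>
  The radial mean \<open>(1 - t) \<Sum> a n t^n\<close> weights all coefficients with total mass 1, and as
  \<open>t\<close> tends to 1 the mass of any finite initial segment disappears. So a null sequence has null
  means, and only the leading asymptotics of the coefficients matter at the boundary.
\<close>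

lemma tendsto_Abel_mean_zero:
  fixes a :: "nat \<Rightarrow> complex"
  assumes "a \<longlonglongrightarrow> 0"
  shows "((\<lambda>t::real. of_real (1 - t) * (\<Sum>n. a n * of_real t ^ n)) \<longlongrightarrow> 0) (at_left 1)"
proof (rule tendstoI)
  fix e :: real assume e: "e > 0"
  obtain N where N: "\<And>n. n \<ge> N \<Longrightarrow> norm (a n) \<le> e / 2"
    using LIMSEQ_D[OF assms, of "e / 2"] e by (metis diff_zero half_gt_zero less_imp_le)
  define B where "B = (\<Sum>n<N. norm (a n))"
  have "((\<lambda>t. (1 - t) * B) \<longlongrightarrow> (1 - 1) * B) (at_left 1)" by (intro tendsto_intros)
  then have "\<forall>\<^sub>F t in at_left 1. (1 - t) * B < e / 2" using e by (intro order_tendstoD) auto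
  moreover have "\<forall>\<^sub>F t::real in at_left 1. 0 < t \<and> t < 1"
    using eventually_at_left_real[of 0 1] by simp
  ultimately show "\<forall>\<^sub>F t in at_left 1. dist (of_real (1 - t) * (\<Sum>n. a n * of_real t ^ n)) 0 < e"
  proof eventually_elim
    case (elim t)
    define b where "b = (\<lambda>n. (if n < N then norm (a n) else 0) + e / 2 * t ^ n)"
    have "(\<lambda>n. e / 2 * t ^ n) sums (e / 2 * (1 / (1 - t)))"
      using elim by (intro sums_mult geometric_sums) auto
    moreover have "(\<lambda>n. if n \<in> {..<N} then norm (a n) else 0) sums B"
      unfolding B_def by (rule sums_If_finite_set) simp
    ultimately have b: "b sums (B + e / 2 * (1 / (1 - t)))"
      unfolding b_def using sums_add by force
    have le: "norm (a n * of_real t ^ n) \<le> b n" for n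
    proof -
      have "t ^ n \<le> 1" "t ^ n \<ge> 0" using elim by (auto intro: power_le_one)
      then show ?thesis
        using N[of n] e elim mult_left_mono[of "t ^ n" 1 "norm (a n)"]
        by (auto simp: b_def norm_mult norm_power intro!: mult_right_mono add_increasing2)
    qed
    have "norm (\<Sum>n. a n * of_real t ^ n) \<le> suminf b"
      by (rule norm_suminf_le[OF le sums_summable[OF b]])
    then have "(1 - t) * norm (\<Sum>n. a n * of_real t ^ n) \<le> (1 - t) * (B + e / 2 * (1 / (1 - t)))"
      using elim by (intro mult_left_mono) (auto simp: sums_unique[OF b, symmetric])
    also have "\<dots> = (1 - t) * B + e / 2" using elim by (simp add: field_simps)
    also have "\<dots> < e" using elim by simp
    finally show ?case using elim by (simp add: norm_mult flip: of_real_diff)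
  qed
qed

lemma hypergeo_coeff_asymp:
  fixes a b c :: complex
  assumes c: "c \<notin> \<int>\<^sub>\<le>\<^sub>0"
  shows "(\<lambda>n. of_nat n * fps_nth (fps_hypergeo [a, b] [c] 1) n / of_nat n powr (a + b - c))
           \<longlonglongrightarrow> Gamma c * rGamma a * rGamma b"
proof -
  define A where "A = (\<lambda>z n. pochhammer z n / (fact n * of_nat n powr (z - 1)) :: complex)"
  have "(\<lambda>n. A a n * A b n / A c n) \<longlonglongrightarrow> rGamma a * rGamma b / rGamma c"
    unfolding A_def using c by (intro tendsto_intros pochhammer_asymp) (auto simp: rGamma_eq_zero_iff)
  moreover have "\<forall>\<^sub>F n in sequentially. A a n * A b n / A c n
      = of_nat n * fps_nth (fps_hypergeo [a, b] [c] 1) n / of_nat n powr (a + b - c)"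
    using eventually_gt_at_top[of 0]
  proof eventually_elim
    case (elim n)
    have "of_nat n powr (a + b - c) = of_nat n powr (a - 1) * of_nat n powr (b - 1)
            * of_nat n / (of_nat n powr (c - 1) :: complex)"
      using elim by (simp add: powr_add powr_diff)
    then show ?case using elim by (simp add: A_def fps_hypergeo_nth)
  qed
  moreover have "rGamma a * rGamma b / rGamma c = Gamma c * rGamma a * rGamma b"
    by (simp add: Gamma_def divide_inverse mult_ac)
  ultimately show ?thesis by (simp add: tendsto_cong)
qed

lemma norm_nat_powr_imaginary:
  assumes "Re z = 0" "n > 0"
  shows "norm (of_nat n powr z) = 1"
  using norm_powr_real_powr[of "of_nat n" z] assms by simp

lemma hypergeo_coeff_tendsto_0:
  fixes a b c :: complex
  assumes c: "c \<notin> \<int>\<^sub>\<le>\<^sub>0" and re: "Re (a + b - c) = 0"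
  shows "(\<lambda>n. fps_nth (fps_hypergeo [a, b] [c] 1) n) \<longlonglongrightarrow> 0"
proof -
  let ?f = "\<lambda>n. fps_nth (fps_hypergeo [a, b] [c] 1) n"
  have "(\<lambda>n. norm (of_nat n * ?f n / of_nat n powr (a + b - c)) * inverse (real n))
      \<longlonglongrightarrow> norm (Gamma c * rGamma a * rGamma b) * 0"
    by (intro tendsto_mult tendsto_norm hypergeo_coeff_asymp c lim_inverse_n)
  moreover have "\<forall>\<^sub>F n in sequentially.
      norm (of_nat n * ?f n / of_nat n powr (a + b - c)) * inverse (real n) = norm (?f n)"
    using eventually_gt_at_top[of 0]
    by eventually_elim (use re in \<open>simp add: norm_mult norm_divide norm_nat_powr_imaginary\<close>)
  ultimately show ?thesis by (simp add: tendsto_cong tendsto_norm_zero_iff)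
qed

lemma conv_radius_hypergeo_ge_1:
  fixes a b c :: complex
  assumes c: "c \<notin> \<int>\<^sub>\<le>\<^sub>0" and re: "Re (a + b - c) = 0"
  shows "fps_conv_radius (fps_hypergeo [a, b] [c] 1) \<ge> 1"
  unfolding fps_conv_radius_def
proof (rule conv_radius_geI_ex')
  let ?f = "\<lambda>n. fps_nth (fps_hypergeo [a, b] [c] 1) n"
  fix r :: real assume r: "0 < r" "ereal r < 1"
  then have r1: "r < 1" by simp
  obtain K where K: "\<And>n. norm (?f n) \<le> K"
    using convergent_imp_Bseq[OF convergentI[OF hypergeo_coeff_tendsto_0[OF assms]]]
    by (metis BseqE)
  have "summable (\<lambda>n. K * r ^ n)" using r r1 by (intro summable_mult summable_geometric) auto
  then show "summable (\<lambda>n. ?f n * of_real r ^ n)"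
  proof (rule summable_comparison_test'[where N = 0])
    show "norm (?f n * of_real r ^ n) \<le> K * r ^ n" for n
      using K[of n] r unfolding norm_mult norm_power
      by (intro mult_mono) (auto simp del: fps_hypergeo_nth intro: order_trans[OF norm_ge_zero])
  qed
qed

text \<open>
  When \<open>\<delta> = a + b - c\<close> is imaginary, the coefficients of \<open>z F'(z)\<close> behave like a constant times
  \<open>n powr \<delta>\<close>, and so do those of \<open>(1 - z) powr (-1 - \<delta>)\<close> by the binomial series. The two series,
  after scaling, therefore differ by null coefficients, which the factor \<open>1 - t\<close> kills; since
  \<open>(1 - t) powr (- \<delta>)\<close> has modulus 1, the modulus of \<open>(1 - t) F'(t)\<close> converges. It is essential to
  compare with the binomial series rather than to sum absolute values: this comparison is what
  produces the factor \<open>Gamma (1 + \<delta>)\<close>, which decays exponentially in \<open>|\<delta>|\<close> and balances the growth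
  of \<open>rGamma a\<close> and \<open>rGamma b\<close>.
\<close>

lemma hypergeo_deriv_boundary:
  fixes a b c :: complex
  defines "F \<equiv> fps_hypergeo [a, b] [c] 1"
  assumes c: "c \<notin> \<int>\<^sub>\<le>\<^sub>0" and re: "Re (a + b - c) = 0"
  shows "((\<lambda>t. norm (of_real (1 - t) * eval_fps (fps_deriv F) (of_real t)))
           \<longlongrightarrow> norm (Gamma c * Gamma (1 + (a + b - c)) * rGamma a * rGamma b)) (at_left 1)"
proof -
  define \<delta> where "\<delta> = a + b - c"
  have \<delta>: "Re \<delta> = 0" "1 + \<delta> \<notin> \<int>\<^sub>\<le>\<^sub>0"
  proof -
    show re\<delta>: "Re \<delta> = 0" using re by (simp add: \<delta>_def)
    show "1 + \<delta> \<notin> \<int>\<^sub>\<le>\<^sub>0"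
    proof
      assume "1 + \<delta> \<in> \<int>\<^sub>\<le>\<^sub>0"
      then obtain k where k: "k \<le> 0" "1 + \<delta> = of_int k" by (elim nonpos_Ints_cases) auto
      have "Re (1 + \<delta>) = of_int k" unfolding k(2) by simp
      then show False using k(1) re\<delta> by simp
    qed
  qed
  define L where "L = Gamma c * Gamma (1 + \<delta>) * rGamma a * rGamma b"
  define d where "d = (\<lambda>n. of_nat n * fps_nth F n - L * (pochhammer (1 + \<delta>) n / fact n))"
  have "(\<lambda>n. norm (of_nat n * fps_nth F n / of_nat n powr \<delta>
           - L * (pochhammer (1 + \<delta>) n / (fact n * of_nat n powr (1 + \<delta> - 1)))))
         \<longlonglongrightarrow> norm (Gamma c * rGamma a * rGamma b - L * rGamma (1 + \<delta>))"
    unfolding F_def \<delta>_def by (intro tendsto_intros hypergeo_coeff_asymp c pochhammer_asymp)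
  also have "Gamma c * rGamma a * rGamma b - L * rGamma (1 + \<delta>) = 0"
    using \<delta>(2) by (simp add: L_def Gamma_def rGamma_eq_zero_iff)
  finally have "(\<lambda>n. norm (d n)) \<longlonglongrightarrow> norm (0 :: complex)"
  proof (rule Lim_transform_eventually)
    show "\<forall>\<^sub>F n in sequentially. norm (of_nat n * fps_nth F n / of_nat n powr \<delta>
           - L * (pochhammer (1 + \<delta>) n / (fact n * of_nat n powr (1 + \<delta> - 1)))) = norm (d n)"
      using eventually_gt_at_top[of 0]
    proof eventually_elim
      case (elim n)
      have "of_nat n * fps_nth F n / of_nat n powr \<delta>
           - L * (pochhammer (1 + \<delta>) n / (fact n * of_nat n powr (1 + \<delta> - 1)))
           = d n / of_nat n powr \<delta>"
        using elim by (simp add: d_def diff_divide_distrib)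
      then show ?case using norm_nat_powr_imaginary[OF \<delta>(1) elim] by (simp add: norm_divide)
    qed
  qed
  then have d: "d \<longlonglongrightarrow> 0" by (simp add: tendsto_norm_zero_iff)
  define G where "G = (\<lambda>t::real. of_real (1 - t) * (of_real t * eval_fps (fps_deriv F) (of_real t)))"
  have "\<forall>\<^sub>F t::real in at_left 1. 0 < t \<and> t < 1"
    using eventually_at_left_real[of 0 1] by simp
  then have ev: "\<forall>\<^sub>F t::real in at_left 1. of_real (1 - t) * (\<Sum>n. d n * of_real t ^ n)
      = G t - L * of_real (1 - t) powr (- \<delta>)"
  proof eventually_elim
    case (elim t)
    have "ereal (norm (of_real t :: complex)) < 1" using elim by simp
    then have "ereal (norm (of_real t :: complex)) < fps_conv_radius F"
      using conv_radius_hypergeo_ge_1[OF c re] unfolding F_def by (rule less_le_trans)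
    then have "(\<lambda>n. fps_nth (fps_deriv F) n * of_real t ^ n) sums eval_fps (fps_deriv F) (of_real t)"
      using fps_conv_radius_deriv[of F] by (intro sums_eval_fps) auto
    then have "(\<lambda>n. of_real t * (fps_nth (fps_deriv F) n * of_real t ^ n))
        sums (of_real t * eval_fps (fps_deriv F) (of_real t))" by (rule sums_mult)
    then have "(\<lambda>n. of_nat (Suc n) * fps_nth F (Suc n) * of_real t ^ Suc n)
        sums (of_real t * eval_fps (fps_deriv F) (of_real t))" by (simp add: mult_ac)
    then have s1: "(\<lambda>n. of_nat n * fps_nth F n * of_real t ^ n)
        sums (of_real t * eval_fps (fps_deriv F) (of_real t))"
      by (subst (asm) sums_Suc_iff) simp
    have "(\<lambda>n. ((-1 - \<delta>) gchoose n) * (- of_real t) ^ n) sums (1 + - of_real t) powr (-1 - \<delta>)"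
      using elim by (intro gen_binomial_complex) simp
    also have "(\<lambda>n. ((-1 - \<delta>) gchoose n) * (- of_real t :: complex) ^ n)
        = (\<lambda>n. pochhammer (1 + \<delta>) n / fact n * of_real t ^ n)"
      by (intro ext) (simp add: gbinomial_pochhammer power_minus[of "of_real t"] add.commute)
    finally have s2: "(\<lambda>n. pochhammer (1 + \<delta>) n / fact n * of_real t ^ n)
        sums (of_real (1 - t) powr (-1 - \<delta>))" by simp
    have "(\<lambda>n. of_nat n * fps_nth F n * of_real t ^ n - L * (pochhammer (1 + \<delta>) n / fact n * of_real t ^ n))
       sums (of_real t * eval_fps (fps_deriv F) (of_real t) - L * of_real (1 - t) powr (-1 - \<delta>))"
      by (intro sums_diff sums_mult s1 s2)
    then have "(\<Sum>n. d n * of_real t ^ n)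
        = of_real t * eval_fps (fps_deriv F) (of_real t) - L * of_real (1 - t) powr (-1 - \<delta>)"
      by (simp add: d_def algebra_simps sums_iff)
    moreover have "of_real (1 - t) * of_real (1 - t) powr (-1 - \<delta>) = (of_real (1 - t) powr (- \<delta>) :: complex)"
      using elim powr_add[of "of_real (1 - t)" 1 "-1 - \<delta>"] by simp
    ultimately show ?case by (simp add: G_def right_diff_distrib mult.left_commute del: of_real_diff)
  qed
  have "((\<lambda>t. G t - L * of_real (1 - t) powr (- \<delta>)) \<longlongrightarrow> 0) (at_left 1)"
    using Lim_transform_eventually[OF tendsto_Abel_mean_zero[OF d] ev] .
  then have "((\<lambda>t. norm (G t) - norm (L * of_real (1 - t) powr (- \<delta>))) \<longlongrightarrow> 0) (at_left 1)"
    by (rule Lim_null_comparison[rotated, OF tendsto_norm_zero]) (simp add: norm_triangle_ineq3)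
  moreover have "\<forall>\<^sub>F t in at_left 1. norm (G t) - norm (L * of_real (1 - t) powr (- \<delta>)) = norm (G t) - norm L"
    using eventually_at_left_real[of 0 1, simplified]
  proof eventually_elim
    case (elim t)
    then show ?case using norm_powr_real_powr[of "of_real (1 - t)" "- \<delta>"] \<delta>(1)
      by (simp add: norm_mult del: of_real_diff)
  qed
  ultimately have "((\<lambda>t. norm (G t) - norm L) \<longlongrightarrow> 0) (at_left 1)"
    by (rule Lim_transform_eventually)
  then have G: "((\<lambda>t. norm (G t)) \<longlongrightarrow> norm L) (at_left 1)" by (simp add: LIM_zero_iff)
  have "((\<lambda>t. norm (G t) / t) \<longlongrightarrow> norm L / 1) (at_left 1)"
    by (intro tendsto_divide G tendsto_ident_at) simp
  moreover have "\<forall>\<^sub>F t in at_left 1. norm (G t) / t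
      = norm (of_real (1 - t) * eval_fps (fps_deriv F) (of_real t))"
    using eventually_at_left_real[of 0 1, simplified]
    by eventually_elim (simp add: G_def norm_mult)
  ultimately show ?thesis unfolding L_def \<delta>_def by (simp add: tendsto_cong)
qed

lemma hypergeo_boundary:
  fixes a b c :: complex
  assumes c: "c \<notin> \<int>\<^sub>\<le>\<^sub>0" and re: "Re (a + b - c) = 0"
  shows "((\<lambda>t. of_real (1 - t) * eval_fps (fps_hypergeo [a, b] [c] 1) (of_real t)) \<longlongrightarrow> 0) (at_left 1)"
  unfolding eval_fps_def by (intro tendsto_Abel_mean_zero hypergeo_coeff_tendsto_0 assms)

lemma fps_hypergeo_ODE:
  fixes a b c :: "'a :: field_char_0"
  defines "F \<equiv> fps_hypergeo [a, b] [c] 1"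
  assumes c: "\<And>n. c + of_nat n \<noteq> 0"
  shows "fps_X * fps_deriv (fps_deriv F) - fps_X * (fps_X * fps_deriv (fps_deriv F))
           + (fps_const c * fps_deriv F - fps_const (a + b + 1) * (fps_X * fps_deriv F))
         = fps_const (a * b) * F"
proof (rule fps_ext)
  fix n
  have rec: "fps_nth F (Suc k) * ((c + of_nat k) * (1 + of_nat k)) = (a + of_nat k) * (b + of_nat k) * fps_nth F k" for k
  proof -
    have "1 + of_nat k \<noteq> (0 :: 'a)" by (metis of_nat_Suc of_nat_neq_0)
    moreover have "fps_nth F (Suc k) = (a + of_nat k) * (b + of_nat k) / ((1 + of_nat k) * (c + of_nat k)) * fps_nth F k"
      unfolding F_def by (subst fps_hypergeo_rec) (simp del: fps_hypergeo_nth)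
    ultimately show ?thesis using c[of k] by (simp add: divide_simps mult.commute)
  qed
  show "fps_nth (fps_X * fps_deriv (fps_deriv F) - fps_X * (fps_X * fps_deriv (fps_deriv F))
           + (fps_const c * fps_deriv F - fps_const (a + b + 1) * (fps_X * fps_deriv F))) n
         = fps_nth (fps_const (a * b) * F) n"
  proof (cases n)
    case 0
    then show ?thesis using rec[of 0] by (simp add: algebra_simps)
  next
    case (Suc k)
    then show ?thesis using rec[of n]
      by (cases k) (simp_all add: algebra_simps)
  qed
qed

lemma hypergeo_ODE:
  fixes a b c z :: complex
  defines "F \<equiv> fps_hypergeo [a, b] [c] 1"
  assumes c: "c \<notin> \<int>\<^sub>\<le>\<^sub>0" and z: "norm z < fps_conv_radius F"
  shows "z * (1 - z) * eval_fps (fps_deriv (fps_deriv F)) z + (c - (a + b + 1) * z) * eval_fps (fps_deriv F) z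
         = a * b * eval_fps F z"
proof -
  have nz: "c + of_nat n \<noteq> 0" for n
    using c by (metis add_eq_0_iff2 minus_of_nat_in_nonpos_Ints)
  define F1 F2 where "F1 = fps_deriv F" and "F2 = fps_deriv F1"
  have r: "norm z < fps_conv_radius F1" "norm z < fps_conv_radius F2"
    using z fps_conv_radius_deriv[of F] fps_conv_radius_deriv[of F1]
    by (auto simp: F1_def F2_def)
  have m: "norm z < fps_conv_radius (g * h) \<and> eval_fps (g * h) z = eval_fps g z * eval_fps h z"
    if "norm z < fps_conv_radius g" "norm z < fps_conv_radius h" for g h :: "complex fps"
    using that less_le_trans[OF _ fps_conv_radius_mult, of "norm z" g h] by (auto simp: eval_fps_mult)
  have s: "norm z < fps_conv_radius (g - h) \<and> eval_fps (g - h) z = eval_fps g z - eval_fps h z"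
    if "norm z < fps_conv_radius g" "norm z < fps_conv_radius h" for g h :: "complex fps"
    using that less_le_trans[OF _ fps_conv_radius_diff, of "norm z" g h] by (auto simp: eval_fps_diff)
  have "eval_fps (fps_X * F2 - fps_X * (fps_X * F2)
           + (fps_const c * F1 - fps_const (a + b + 1) * (fps_X * F1))) z
         = (z * eval_fps F2 z - z * (z * eval_fps F2 z))
           + (c * eval_fps F1 z - (a + b + 1) * (z * eval_fps F1 z))"
    using r by (subst eval_fps_add) (simp_all add: m s)
  moreover have "eval_fps (fps_const (a * b) * F) z = a * b * eval_fps F z"
    using m[of "fps_const (a * b)" F] z by simp
  ultimately show ?thesis
    using fps_hypergeo_ODE[OF nz, of a b] unfolding F_def[symmetric] F1_def[symmetric] F2_def[symmetric]
    by (simp add: algebra_simps)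
qed

section \<open>Liouville normal form and the uniform bound\<close>

text \<open>
  The algebra behind the Liouville normal form, with \<open>T = tanh x\<close>. The functions \<open>\<phi>\<close> and \<open>\<phi>1\<close> are
  the logarithmic derivative of the gauge factor \<open>tanh x powr k * cosh x powr (- e)\<close> and its
  derivative, and \<open>2 T (1 - T\<^sup>2)\<close> and \<open>(1 - T\<^sup>2) (2 - 6 T\<^sup>2)\<close> are the first two derivatives of
  \<open>tanh\<^sup>2\<close>. The first identity says that the gauge factor turns Gauss's equation into
  \<open>w'' = (V + e\<^sup>2) w\<close> with a potential that is real for real \<open>c\<close> and \<open>d\<close>; the second that the first-order term cancels, which is
  what determines the exponents.
\<close>

lemma jacobi_normal_form_coeffs:
  fixes c d e T :: complex
  assumes "T \<noteq> 0"
  defines "a \<equiv> (c + d + e) / 2" and "b \<equiv> (c - d + e) / 2" and "k \<equiv> c - 1 / 2"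
  defines "\<phi> \<equiv> k * (1 - T\<^sup>2) / T - e * T" and "\<phi>1 \<equiv> (1 - T\<^sup>2) * (- k / T\<^sup>2 - k - e)"
  shows "\<phi>\<^sup>2 + \<phi>1 + 4 * (1 - T\<^sup>2) * (a * b)
           = (1 - T\<^sup>2) * ((k\<^sup>2 - k) / T\<^sup>2 - (d\<^sup>2 - 1 / 4)) + e\<^sup>2"
    and "2 * \<phi> * (2 * T * (1 - T\<^sup>2)) + (1 - T\<^sup>2) * (2 - 6 * T\<^sup>2)
           - 4 * (1 - T\<^sup>2) * (c - (a + b + 1) * T\<^sup>2) = 0"
  using assms(1) unfolding \<phi>_def \<phi>1_def a_def b_def k_def
  by (simp_all add: field_simps power2_eq_square)

text \<open>
  Multiplying \<open>F (tanh\<^sup>2 x)\<close> by \<open>tanh x powr (c - 1/2)\<close> and the phase \<open>cosh x powr (- i lam)\<close> gives a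
  solution of the Schroedinger equation with the potential
  \<open>((c - 1)\<^sup>2 - 1/4) / sinh\<^sup>2 x - (d\<^sup>2 - 1/4) / cosh\<^sup>2 x\<close>. The conditions on \<open>d\<close> make it nonnegative and
  make its decay rate at least 2, so the energy bound applies, and the asymptotic energy is given by
  the boundary behaviour of \<open>F\<close> and \<open>F'\<close> at 1. In the resulting bound \<open>c\<close> and \<open>d\<close>
  occur only in the Gamma factors.
\<close>

lemma hypergeo_uniform_bound:
  fixes c d lam r :: real
  defines "a \<equiv> (of_real (c + d) + \<i> * of_real lam) / 2" and "b \<equiv> (of_real (c - d) + \<i> * of_real lam) / 2"
  defines "F \<equiv> fps_hypergeo [a, b] [of_real c] 1"
  assumes lam: "lam \<noteq> 0" and d: "1 / 2 \<le> d" "d \<le> c - 1" and r: "0 < r" "r < 1"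
  shows "r powr (c - 1 / 2) * norm (eval_fps F (of_real (r\<^sup>2)))
           \<le> (1 + sqrt 2 / \<bar>lam\<bar>) * (2 * norm (Gamma (of_real c) * Gamma (1 + \<i> * of_real lam) * rGamma a * rGamma b))"
proof -
  define k where "k = c - 1 / 2"
  have k: "k \<ge> 1" using d by (simp add: k_def)
  have c: "complex_of_real c \<notin> \<int>\<^sub>\<le>\<^sub>0"
    using d nonpos_Ints_nonpos[of c] by (auto simp: of_real_in_nonpos_Ints_iff)
  have ab: "a + b - of_real c = \<i> * of_real lam" by (simp add: a_def b_def field_simps)
  then have re: "Re (a + b - of_real c) = 0" by simp
  define T :: "real \<Rightarrow> real" where "T = tanh"
  have T: "0 < T x" "T x < 1" "(T x)\<^sup>2 < 1" if "x > 0" for x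
    using that tanh_real_lt_1[of x] by (auto simp: T_def abs_square_less_1)
  have T2: "(T x)\<^sup>2 < 1" for x
    using tanh_real_bounds[of x] by (auto simp: T_def abs_square_less_1)
  have conv: "ereal (norm (complex_of_real ((T x)\<^sup>2))) < fps_conv_radius F" for x
  proof -
    have "ereal (norm (complex_of_real ((T x)\<^sup>2))) < 1" using T2[of x] by (simp del: of_real_power)
    also have "1 \<le> fps_conv_radius F" unfolding F_def by (rule conv_radius_hypergeo_ge_1[OF c re])
    finally show ?thesis .
  qed
  have conv1: "ereal (norm (complex_of_real ((T x)\<^sup>2))) < fps_conv_radius (fps_deriv F)" for x
    using conv[of x] fps_conv_radius_deriv[of F] by (rule less_le_trans)
  define S S1 S2 q where "S = (\<lambda>x. eval_fps F (of_real ((T x)\<^sup>2)))"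
    and "S1 = (\<lambda>x. eval_fps (fps_deriv F) (of_real ((T x)\<^sup>2)))"
    and "S2 = (\<lambda>x. eval_fps (fps_deriv (fps_deriv F)) (of_real ((T x)\<^sup>2)))"
    and "q = (\<lambda>x. 2 * T x * (1 - (T x)\<^sup>2))"
  have dT: "(T has_real_derivative 1 - (T x)\<^sup>2) (at x)" for x
    unfolding T_def by (auto intro!: derivative_eq_intros)
  have dT2: "((\<lambda>x. complex_of_real ((T x)\<^sup>2)) has_vector_derivative of_real (q x)) (at x)" for x
    unfolding q_def by (rule has_vector_derivative_of_real) (auto intro!: derivative_eq_intros dT)
  have dS: "(S has_vector_derivative of_real (q x) * S1 x) (at x)"
    and dS1: "(S1 has_vector_derivative of_real (q x) * S2 x) (at x)" for x
    using field_vector_diff_chain_at[OF dT2 has_field_derivative_eval_fps[OF conv[of x]]]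
      field_vector_diff_chain_at[OF dT2 has_field_derivative_eval_fps[OF conv1[of x]]]
    by (simp_all add: S_def S1_def S2_def o_def)
  have ode: "of_real ((T x)\<^sup>2 * (1 - (T x)\<^sup>2)) * S2 x
      = a * b * S x - (of_real c - (a + b + 1) * of_real ((T x)\<^sup>2)) * S1 x" for x
    using hypergeo_ODE[OF c, of "of_real ((T x)\<^sup>2)" a b] conv[of x]
    unfolding F_def[symmetric] S_def S1_def S2_def by (simp add: algebra_simps)
  \<comment> \<open>The gauge factor, its logarithmic derivative, and the derivative of the latter.\<close>
  define g where "g = (\<lambda>x. exp (of_real (k * ln (T x)) - \<i> * of_real (lam * ln (cosh x))))"
  define \<phi> where "\<phi> = (\<lambda>x. of_real (k * (1 - (T x)\<^sup>2) / T x) - \<i> * of_real (lam * T x))"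
  define \<phi>1 where "\<phi>1 = (\<lambda>x. of_real ((1 - (T x)\<^sup>2) * (- k / (T x)\<^sup>2 - k)) - \<i> * of_real (lam * (1 - (T x)\<^sup>2)))"
  have norm_g: "norm (g x) = T x powr k" if "x > 0" for x
    using T[OF that] by (simp add: g_def powr_def)
  have dg: "(g has_vector_derivative g x * \<phi> x) (at x)" if x: "x > 0" for x
  proof -
    have "((\<lambda>x. k * ln (T x)) has_real_derivative k * (1 - (T x)\<^sup>2) / T x) (at x)"
      using T[OF x] by (auto intro!: derivative_eq_intros dT)
    moreover have "((\<lambda>x. lam * ln (cosh x)) has_real_derivative lam * T x) (at x)"
      using cosh_real_pos[of x] by (auto intro!: derivative_eq_intros simp: T_def tanh_def)
    ultimately have "((\<lambda>x. of_real (k * ln (T x)) - \<i> * of_real (lam * ln (cosh x))) has_vector_derivative \<phi> x) (at x)"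
      unfolding \<phi>_def by (intro has_vector_derivative_diff has_vector_derivative_mult_right has_vector_derivative_of_real)
    from field_vector_diff_chain_at[OF this DERIV_exp] show ?thesis
      by (simp add: g_def o_def mult.commute)
  qed
  have d\<phi>: "(\<phi> has_vector_derivative \<phi>1 x) (at x)" if x: "x > 0" for x
  proof -
    have "((\<lambda>x. k * (1 - (T x)\<^sup>2) / T x) has_real_derivative (1 - (T x)\<^sup>2) * (- k / (T x)\<^sup>2 - k)) (at x)"
      using T[OF x] by (auto intro!: derivative_eq_intros dT simp: field_simps power2_eq_square)
    moreover have "((\<lambda>x. lam * T x) has_real_derivative lam * (1 - (T x)\<^sup>2)) (at x)"
      by (auto intro!: derivative_eq_intros dT)
    ultimately show ?thesis
      unfolding \<phi>_def \<phi>1_def by (intro has_vector_derivative_diff has_vector_derivative_mult_right has_vector_derivative_of_real)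
  qed
  define q1 where "q1 = (\<lambda>x. (1 - (T x)\<^sup>2) * (2 - 6 * (T x)\<^sup>2))"
  have dq: "((\<lambda>x. complex_of_real (q x)) has_vector_derivative of_real (q1 x)) (at x)" for x
    unfolding q_def q1_def
    by (rule has_vector_derivative_of_real) (auto intro!: derivative_eq_intros dT simp: algebra_simps power2_eq_square)
  define w where "w = (\<lambda>x. g x * S x)"
  define w1 where "w1 = (\<lambda>x. g x * (\<phi> x * S x + of_real (q x) * S1 x))"
  define V where "V = (\<lambda>x. (1 - (T x)\<^sup>2) * ((k\<^sup>2 - k) / (T x)\<^sup>2 - (d\<^sup>2 - 1 / 4)))"
  have dw: "(w has_vector_derivative w1 x) (at x)" if "x > 0" for x
    unfolding w_def
    by (rule has_vector_derivative_eq_rhs[OF has_vector_derivative_mult[OF dg[OF that] dS]])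
       (simp add: w1_def algebra_simps)
  have dw1: "(w1 has_vector_derivative of_real (V x - lam\<^sup>2) * w x) (at x)" if x: "x > 0" for x
  proof -
    define \<tau> e where "\<tau> = complex_of_real (T x)" and "e = \<i> * of_real lam"
    have \<tau>: "\<tau> \<noteq> 0" using T[OF x] by (simp add: \<tau>_def)
    have "of_real (q x) * of_real (q x) * S2 x = 4 * (1 - \<tau>\<^sup>2) * (of_real ((T x)\<^sup>2 * (1 - (T x)\<^sup>2)) * S2 x)"
      by (simp add: q_def \<tau>_def power2_eq_square algebra_simps)
    also have "\<dots> = 4 * (1 - \<tau>\<^sup>2) * (a * b * S x - (of_real c - (a + b + 1) * \<tau>\<^sup>2) * S1 x)"
      unfolding ode by (simp add: \<tau>_def)
    finally have q2: "of_real (q x) * of_real (q x) * S2 x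
        = 4 * (1 - \<tau>\<^sup>2) * (a * b * S x - (of_real c - (a + b + 1) * \<tau>\<^sup>2) * S1 x)" .
    have e: "\<phi> x = of_real k * (1 - \<tau>\<^sup>2) / \<tau> - e * \<tau>" "\<phi>1 x = (1 - \<tau>\<^sup>2) * (- of_real k / \<tau>\<^sup>2 - of_real k - e)"
      "of_real (q x) = 2 * \<tau> * (1 - \<tau>\<^sup>2)" "of_real (q1 x) = (1 - \<tau>\<^sup>2) * (2 - 6 * \<tau>\<^sup>2)"
      "a = (of_real c + of_real d + e) / 2" "b = (of_real c - of_real d + e) / 2"
      "of_real k = of_real c - 1 / (2 :: complex)"
      "of_real (V x - lam\<^sup>2) = (1 - \<tau>\<^sup>2) * (((of_real k)\<^sup>2 - of_real k) / \<tau>\<^sup>2 - ((of_real d)\<^sup>2 - 1 / 4)) + e\<^sup>2"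
      by (simp_all add: \<phi>_def \<phi>1_def \<tau>_def e_def q_def q1_def a_def b_def V_def k_def algebra_simps)
    have alg1: "(\<phi> x)\<^sup>2 + \<phi>1 x + 4 * (1 - \<tau>\<^sup>2) * (a * b) = of_real (V x - lam\<^sup>2)"
      unfolding e by (rule jacobi_normal_form_coeffs(1)[OF \<tau>])
    have alg2: "2 * \<phi> x * of_real (q x) + of_real (q1 x)
        - 4 * (1 - \<tau>\<^sup>2) * (of_real c - (a + b + 1) * \<tau>\<^sup>2) = 0"
      unfolding e by (rule jacobi_normal_form_coeffs(2)[OF \<tau>])
    have "(w1 has_vector_derivative
        g x * (\<phi> x * (of_real (q x) * S1 x) + \<phi>1 x * S x + (of_real (q x) * (of_real (q x) * S2 x) + of_real (q1 x) * S1 x))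
        + g x * \<phi> x * (\<phi> x * S x + of_real (q x) * S1 x)) (at x)"
      unfolding w1_def
      by (intro has_vector_derivative_mult has_vector_derivative_add dg d\<phi> dS dS1 dq x)
    also have "g x * (\<phi> x * (of_real (q x) * S1 x) + \<phi>1 x * S x + (of_real (q x) * (of_real (q x) * S2 x) + of_real (q1 x) * S1 x))
        + g x * \<phi> x * (\<phi> x * S x + of_real (q x) * S1 x)
      = g x * (((\<phi> x)\<^sup>2 + \<phi>1 x + 4 * (1 - \<tau>\<^sup>2) * (a * b)) * S x
          + (2 * \<phi> x * of_real (q x) + of_real (q1 x) - 4 * (1 - \<tau>\<^sup>2) * (of_real c - (a + b + 1) * \<tau>\<^sup>2)) * S1 x)"
      using q2 by (simp add: mult.assoc[symmetric]) (simp add: algebra_simps power2_eq_square)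
    also have "\<dots> = of_real (V x - lam\<^sup>2) * w x"
      unfolding alg1 alg2 by (simp add: w_def)
    finally show ?thesis .
  qed
  define V' where "V' = (\<lambda>x. - 2 * T x * (1 - (T x)\<^sup>2) * ((k\<^sup>2 - k) / (T x)\<^sup>2 - (d\<^sup>2 - 1 / 4))
     - 2 * (1 - (T x)\<^sup>2)\<^sup>2 * (k\<^sup>2 - k) / (T x) ^ 3)"
  have dV: "(V has_real_derivative V' x) (at x)" if x: "x > 0" for x
    unfolding V_def V'_def using T[OF x]
    by (auto intro!: derivative_eq_intros dT simp: field_simps power2_eq_square power3_eq_cube)
  have kd: "d\<^sup>2 - 1 / 4 \<ge> 0" "k\<^sup>2 - k \<ge> d\<^sup>2 - 1 / 4"
  proof -
    have "(1 / 2)\<^sup>2 \<le> d\<^sup>2" "d\<^sup>2 \<le> (c - 1)\<^sup>2" using d by (intro power_mono; simp)+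
    then show "d\<^sup>2 - 1 / 4 \<ge> 0" "k\<^sup>2 - k \<ge> d\<^sup>2 - 1 / 4"
      by (simp_all add: k_def power2_eq_square field_simps)
  qed
  have V_pos: "V x \<ge> 0" if x: "x > 0" for x
  proof -
    have "(k\<^sup>2 - k) * 1 \<le> (k\<^sup>2 - k) * (1 / (T x)\<^sup>2)"
      using kd T[OF x] by (intro mult_left_mono) auto
    then show ?thesis unfolding V_def using kd T[OF x] by (intro mult_nonneg_nonneg) auto
  qed
  have V_decay: "V' x \<le> - 2 * V x" if x: "x > 0" for x
  proof -
    have "V' x + 2 * V x = - 2 * (1 - T x) * (1 - (T x)\<^sup>2) * ((k\<^sup>2 - k) / (T x) ^ 3 + (d\<^sup>2 - 1 / 4))"
      unfolding V_def V'_def using T[OF x]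
      by (simp add: field_simps power2_eq_square power3_eq_cube)
    also have "\<dots> \<le> 0"
      using kd T[OF x] by (intro mult_nonpos_nonneg mult_nonneg_nonneg add_nonneg_nonneg divide_nonneg_nonneg) auto
    finally show ?thesis by simp
  qed
  have cont_S: "isCont S x" "isCont S1 x" for x
    using has_vector_derivative_continuous[OF dS] has_vector_derivative_continuous[OF dS1] by auto
  have regular: "((\<lambda>x. w1 x * cnj (w x)) \<longlongrightarrow> 0) (at_right 0)"
  proof -
    have T0: "(T \<longlongrightarrow> 0) (at_right 0)" unfolding T_def by (auto intro!: tendsto_eq_intros)
    have S0: "(S \<longlongrightarrow> S 0) (at_right 0)" "(S1 \<longlongrightarrow> S1 0) (at_right 0)"
      using cont_S[of 0] by (auto simp: isCont_def intro: filterlim_mono at_le)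
    have ev: "\<forall>\<^sub>F x::real in at_right 0. x > 0" by (simp add: eventually_at_right_less)
    have "((\<lambda>x. T x powr (2 * k - 1)) \<longlongrightarrow> 0) (at_right 0)"
      by (rule tendsto_zero_powrI[OF T0 tendsto_const]) (use k T ev in \<open>auto elim!: eventually_mono intro: less_imp_le\<close>)
    then have "((\<lambda>x. of_real (T x powr (2 * k - 1)) * ((of_real (k * (1 - (T x)\<^sup>2)) - \<i> * of_real (lam * (T x)\<^sup>2)) * S x
        + of_real (2 * (T x)\<^sup>2 * (1 - (T x)\<^sup>2)) * S1 x) * cnj (S x))
      \<longlongrightarrow> of_real 0 * ((of_real (k * (1 - 0\<^sup>2)) - \<i> * of_real (lam * 0\<^sup>2)) * S 0
        + of_real (2 * 0\<^sup>2 * (1 - 0\<^sup>2)) * S1 0) * cnj (S 0)) (at_right 0)"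
      by (intro tendsto_intros T0 S0)
    then have "((\<lambda>x. of_real (T x powr (2 * k - 1)) * ((of_real (k * (1 - (T x)\<^sup>2)) - \<i> * of_real (lam * (T x)\<^sup>2)) * S x
        + of_real (2 * (T x)\<^sup>2 * (1 - (T x)\<^sup>2)) * S1 x) * cnj (S x)) \<longlongrightarrow> 0) (at_right 0)" by simp
    then show ?thesis
    proof (rule Lim_transform_eventually)
      show "\<forall>\<^sub>F x in at_right 0. of_real (T x powr (2 * k - 1)) * ((of_real (k * (1 - (T x)\<^sup>2)) - \<i> * of_real (lam * (T x)\<^sup>2)) * S x
        + of_real (2 * (T x)\<^sup>2 * (1 - (T x)\<^sup>2)) * S1 x) * cnj (S x) = w1 x * cnj (w x)"
        using ev
      proof eventually_elim
        case (elim x)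
        have "w1 x * cnj (w x) = (g x * cnj (g x)) * ((\<phi> x * S x + of_real (q x) * S1 x) * cnj (S x))"
          by (simp add: w_def w1_def)
        also have "g x * cnj (g x) = of_real (T x powr (2 * k - 1)) * of_real (T x)"
        proof -
          have "T x powr (2 * k) = T x powr (2 * k - 1) * T x"
            using T[OF elim] powr_add[of "T x" "2 * k - 1" 1] by simp
          moreover have "(T x powr k)\<^sup>2 = T x powr (2 * k)"
            using powr_add[of "T x" k k] by (simp add: power2_eq_square)
          ultimately show ?thesis using norm_g[OF elim] by (simp add: complex_norm_square[symmetric] flip: of_real_mult)
        qed
        finally have w1w: "w1 x * cnj (w x) = of_real (T x powr (2 * k - 1)) * of_real (T x)
            * ((\<phi> x * S x + of_real (q x) * S1 x) * cnj (S x))" .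
        have e1: "of_real (k * (1 - (T x)\<^sup>2)) - \<i> * of_real (lam * (T x)\<^sup>2) = of_real (T x) * \<phi> x"
          using T[OF elim] by (simp add: \<phi>_def field_simps power2_eq_square)
        have e2: "complex_of_real (2 * (T x)\<^sup>2 * (1 - (T x)\<^sup>2)) = of_real (T x) * of_real (q x)"
          by (simp add: q_def power2_eq_square)
        show ?case unfolding w1w e1 e2 by (simp add: algebra_simps)
      qed
    qed
  qed
  define M where "M = 2 * norm (Gamma (of_real c) * Gamma (1 + \<i> * of_real lam) * rGamma a * rGamma b)"
  have outgoing: "((\<lambda>x. norm (w1 x + \<i> * of_real lam * w x)) \<longlongrightarrow> M) at_top"
  proof -
    have ev: "\<forall>\<^sub>F x::real in at_top. x > 0" by (rule eventually_gt_at_top)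
    have T1: "(T \<longlongrightarrow> 1) at_top" unfolding T_def by (rule tanh_real_at_top)
    have lim: "filterlim (\<lambda>x. (T x)\<^sup>2) (at_left 1) at_top"
      by (rule tendsto_imp_filterlim_at_left) (use T1 T2 in \<open>auto intro!: tendsto_eq_intros\<close>)
    \<comment> \<open>Up to the gauge factor, the outgoing combination is A + B, where A collects the terms with F
      and vanishes at the boundary, and B is the term with F'.\<close>
    define A B where "A = (\<lambda>x. (of_real (k / T x) + \<i> * of_real (lam / (1 + T x))) * (of_real (1 - (T x)\<^sup>2) * S x))"
      and "B = (\<lambda>x. of_real (2 * T x) * (of_real (1 - (T x)\<^sup>2) * S1 x))"
    have "(A \<longlongrightarrow> (of_real (k / 1) + \<i> * of_real (lam / (1 + 1))) * 0) at_top"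
      unfolding A_def S_def F_def
      by (intro tendsto_intros T1 filterlim_compose[OF hypergeo_boundary[OF c re] lim]) auto
    then have A0: "(A \<longlongrightarrow> 0) at_top" by simp
    have "((\<lambda>x. norm (of_real (2 * T x) :: complex) * norm (of_real (1 - (T x)\<^sup>2) * S1 x))
        \<longlongrightarrow> norm (of_real (2 * 1) :: complex) * norm (Gamma (of_real c) * Gamma (1 + (a + b - of_real c)) * rGamma a * rGamma b)) at_top"
      unfolding S1_def F_def
      by (intro tendsto_intros T1 filterlim_compose[OF hypergeo_deriv_boundary[OF c re] lim])
    then have B0: "((\<lambda>x. norm (B x)) \<longlongrightarrow> M) at_top"
      unfolding B_def M_def norm_mult ab by simp
    have "((\<lambda>x. norm (A x + B x) - norm (B x)) \<longlongrightarrow> 0) at_top"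
    proof (rule Lim_null_comparison[OF _ tendsto_norm_zero[OF A0]])
      have "norm (norm (A x + B x) - norm (B x)) \<le> norm (A x)" for x
        using norm_triangle_ineq3[of "A x + B x" "B x"] by simp
      then show "\<forall>\<^sub>F x in at_top. norm (norm (A x + B x) - norm (B x)) \<le> norm (A x)" by simp
    qed
    from tendsto_add[OF this B0] have AB: "((\<lambda>x. norm (A x + B x)) \<longlongrightarrow> M) at_top" by simp
    have "((\<lambda>x. T x powr k * norm (A x + B x)) \<longlongrightarrow> 1 powr k * M) at_top"
      by (intro tendsto_intros T1 AB) auto
    then have "((\<lambda>x. T x powr k * norm (A x + B x)) \<longlongrightarrow> M) at_top" by simp
    then show ?thesis
    proof (rule Lim_transform_eventually)
      show "\<forall>\<^sub>F x in at_top. T x powr k * norm (A x + B x) = norm (w1 x + \<i> * of_real lam * w x)"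
        using ev
      proof eventually_elim
        case (elim x)
        have "1 + T x \<noteq> 0" using T[OF elim] by simp
        then have "lam / (1 + T x) * (1 - (T x)\<^sup>2) = lam * (1 - T x)"
          by (simp add: field_simps power2_eq_square)
        moreover have "A x = (of_real (k / T x * (1 - (T x)\<^sup>2)) + \<i> * of_real (lam / (1 + T x) * (1 - (T x)\<^sup>2))) * S x"
          unfolding A_def of_real_mult by (simp only: algebra_simps)
        ultimately have Ax: "A x = (of_real (k * (1 - (T x)\<^sup>2) / T x) + \<i> * of_real (lam * (1 - T x))) * S x"
          by (simp only: times_divide_eq_left)
        have "w1 x + \<i> * of_real lam * w x = g x * (A x + B x)"
          by (simp add: Ax B_def w1_def w_def \<phi>_def q_def algebra_simps)
        then show ?case using norm_g[OF elim] by (simp add: norm_mult)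
      qed
    qed
  qed
  \<comment> \<open>The inverse hyperbolic tangent of r.\<close>
  define x where "x = ln (sqrt ((1 + r) / (1 - r)))"
  have Tx: "T x = r"
    using r by (simp add: T_def x_def tanh_ln_real field_simps)
  have x: "x > 0" using r Tx tanh_real_pos_iff[of x] unfolding T_def by simp
  have "norm (w x) \<le> (1 + sqrt 2 / \<bar>lam\<bar>) * M"
    by (rule norm_le_of_repulsive_schroedinger[OF lam dw dw1 dV V_pos V_decay regular outgoing x])
  moreover have "norm (w x) = r powr (c - 1 / 2) * norm (eval_fps F (of_real (r\<^sup>2)))"
    using norm_g[OF x] Tx by (simp add: w_def S_def norm_mult k_def)
  ultimately show ?thesis by (simp add: M_def)
qed

section \<open>The series near the origin\<close>

lemma norm_pochhammer_le:
  fixes z :: complex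
  assumes "norm z \<le> N" "N \<ge> 1"
  shows "norm (pochhammer z n) \<le> N ^ n * fact n"
proof (induction n)
  case (Suc n)
  have "real n \<le> N * real n" using assms(2) mult_right_mono[of 1 N "real n"] by simp
  then have "norm (z + of_nat n) \<le> N * (1 + real n)"
    using norm_triangle_ineq[of z "of_nat n"] assms by (simp add: distrib_left)
  then have "norm (pochhammer z n) * norm (z + of_nat n) \<le> (N ^ n * fact n) * (N * (1 + real n))"
    using Suc assms by (intro mult_mono) auto
  then show ?case unfolding pochhammer_Suc norm_mult by (simp add: algebra_simps)
qed simp

lemma norm_pochhammer_ge_fact:
  fixes c :: real
  assumes "c \<ge> 1"
  shows "fact n \<le> norm (pochhammer (complex_of_real c) n)"
proof -
  have "pochhammer 1 n \<le> pochhammer c n"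
    unfolding pochhammer_prod using assms by (intro prod_mono) auto
  also have "pochhammer c n = norm (pochhammer (complex_of_real c) n)"
  proof -
    have "norm (complex_of_real c + of_nat i) = c + of_nat i" for i
      using assms norm_of_real[of "c + of_nat i", where 'a = complex] by simp
    then show ?thesis by (simp add: pochhammer_prod flip: prod_norm)
  qed
  finally show ?thesis by (simp add: pochhammer_fact)
qed

lemma norm_pochhammer_ge_power:
  fixes z :: complex
  assumes "Re z \<ge> 0"
  shows "norm z ^ n \<le> norm (pochhammer z n)"
proof -
  have "norm z \<le> norm (z + of_nat i)" for i
    using assms power_mono[of "Re z" "Re z + of_nat i" 2] by (simp add: cmod_def)
  then have "(\<Prod>i=0..<n. norm z) \<le> (\<Prod>i=0..<n. norm (z + of_nat i))"
    by (intro prod_mono) auto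
  then show ?thesis by (simp add: pochhammer_prod prod_norm)
qed

lemma fact_mult_fact_le: "fact (p + n) * fact (q + n) \<le> (fact (p + q + n) * fact n :: nat)"
proof -
  have "fact (q + n) * fact (p + n) = pochhammer (1 + n) q * (fact n * fact (p + n))"
    by (simp add: pochhammer_fact pochhammer_product' add.commute[of q] mult_ac)
  also have "\<dots> \<le> pochhammer (1 + (p + n)) q * (fact n * fact (p + n))"
    unfolding pochhammer_prod by (intro mult_right_mono prod_mono) auto
  also have "\<dots> = fact (p + n + q) * fact n"
    by (simp add: pochhammer_fact pochhammer_product' mult_ac)
  finally show ?thesis by (simp add: ac_simps)
qed

text \<open>
  Near the origin the series converges geometrically, uniformly in \<open>p\<close> and \<open>q\<close>. Absorbing the
  prefactor, the \<open>n\<close>-th term contains the Pochhammer symbols of lengths \<open>p + n\<close> and \<open>q + n\<close> over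
  that of length \<open>p + q + n\<close> and \<open>n!\<close>. Bounding them by powers of \<open>N\<close> times factorials leaves a
  quotient of factorials that is at most 1, so the term is at most \<open>(N r) ^ (p + q + 2 n)\<close>.
\<close>

lemma hypergeo_small_bound:
  fixes s s' :: complex and c N r :: real
  assumes N: "norm s \<le> N" "norm s' \<le> N" "N \<ge> 1" and c: "c \<ge> 1" and r: "r \<ge> 0" "N * r \<le> 1 / 2"
  shows "norm (pochhammer s p * pochhammer s' q / pochhammer (of_real c) (p + q)) * r ^ (p + q)
      * norm (hypergeo_2F1 (s + of_nat p) (s' + of_nat q) (of_nat (p + q) + of_real c) (of_real (r\<^sup>2))) \<le> 4 / 3"
proof -
  define A where "A = pochhammer s p * pochhammer s' q / pochhammer (of_real c) (p + q) * of_real r ^ (p + q)"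
  define f where "f = (\<lambda>n. pochhammer (s + of_nat p) n * pochhammer (s' + of_nat q) n /
     (pochhammer (of_nat (p + q) + of_real c) n * fact n) * of_real (r\<^sup>2) ^ n)"
  have term_bound: "norm (A * f n) \<le> (1 / 4) ^ n" for n
  proof -
    have "A * f n = pochhammer s (p + n) * pochhammer s' (q + n) / (pochhammer (of_real c) (p + q + n) * fact n)
        * of_real r ^ (p + q + 2 * n)"
      unfolding pochhammer_product'[of s p n] pochhammer_product'[of s' q n] pochhammer_product'[of _ "p + q" n]
      by (simp add: A_def f_def power_add power_mult power_commutes add_ac mult_ac flip: power_mult)
    then have "norm (A * f n) = norm (pochhammer s (p + n)) * norm (pochhammer s' (q + n))
        / (norm (pochhammer (complex_of_real c) (p + q + n)) * fact n) * r ^ (p + q + 2 * n)"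
      using r by (simp add: norm_mult norm_divide norm_power)
    also have "\<dots> \<le> (N ^ (p + n) * fact (p + n)) * (N ^ (q + n) * fact (q + n))
        / (fact (p + q + n) * fact n) * r ^ (p + q + 2 * n)"
      using N r by (intro mult_right_mono frac_le mult_mono norm_pochhammer_le norm_pochhammer_ge_fact c) auto
    also have "\<dots> = (N * r) ^ (p + q + 2 * n) * (fact (p + n) * fact (q + n) / (fact (p + q + n) * fact n))"
      by (simp add: power_mult_distrib power_add mult_2)
    also have "\<dots> \<le> (1 / 2) ^ (2 * n) * 1"
    proof (intro mult_mono)
      have "(N * r) ^ (p + q + 2 * n) \<le> (1 / 2) ^ (p + q + 2 * n)" using N r by (intro power_mono) auto
      also have "\<dots> \<le> (1 / 2) ^ (2 * n)" by (intro power_decreasing) auto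
      finally show "(N * r) ^ (p + q + 2 * n) \<le> (1 / 2) ^ (2 * n)" .
      have "real (fact (p + n) * fact (q + n)) \<le> real (fact (p + q + n) * fact n)"
        using fact_mult_fact_le by (rule of_nat_mono)
      then show "fact (p + n) * fact (q + n) / (fact (p + q + n) * fact n) \<le> (1 :: real)" by simp
    qed auto
    finally show ?thesis by (simp add: power_mult power2_eq_square)
  qed
  have geo: "(\<lambda>n. (1 / 4 :: real) ^ n) sums (4 / 3)" using geometric_sums[of "1 / 4 :: real"] by simp
  have "norm A * norm (\<Sum>n. f n) \<le> 4 / 3"
  proof (cases "A = 0")
    case False
    have "summable (\<lambda>n. A * f n)"
      by (rule summable_comparison_test'[OF sums_summable[OF geo] term_bound])
    then have "summable f" using False by (rule summable_mult_D)
    then have "A * (\<Sum>n. f n) = (\<Sum>n. A * f n)" by (rule suminf_mult[symmetric])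
    moreover have "norm (\<Sum>n. A * f n) \<le> (\<Sum>n. (1 / 4) ^ n)"
      by (rule norm_suminf_le[OF term_bound sums_summable[OF geo]])
    ultimately show ?thesis using geo by (simp add: sums_iff flip: norm_mult)
  qed simp
  moreover have "norm A = norm (pochhammer s p * pochhammer s' q / pochhammer (of_real c) (p + q)) * r ^ (p + q)"
    unfolding A_def norm_mult[of _ "of_real r ^ (p + q)"] using r by (simp add: norm_power)
  ultimately show ?thesis unfolding hypergeo_2F1_eq_suminf f_def by simp
qed


section \<open>Size of the c-function\<close>

lemma norm_Gamma_1_plus_imaginary:
  assumes "t \<noteq> 0"
  shows "(norm (Gamma (1 + \<i> * of_real t)))\<^sup>2 = pi * t / sinh (pi * t)"
proof -
  define z where "z = \<i> * complex_of_real t"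
  have z: "z \<noteq> 0" using assms by (simp add: z_def)
  have "z \<notin> \<int>\<^sub>\<le>\<^sub>0"
  proof
    assume "z \<in> \<int>\<^sub>\<le>\<^sub>0"
    then have "Im z = 0" by (elim nonpos_Ints_cases) simp
    then show False using assms by (simp add: z_def)
  qed
  then have G: "Gamma (1 + z) = z * Gamma z" using Gamma_plus1[of z] by (simp add: add.commute)
  have "of_real ((norm (Gamma (1 + z)))\<^sup>2) = Gamma (1 + z) * Gamma (1 - z)"
    unfolding complex_norm_square cnj_Gamma by (simp add: z_def)
  also have "\<dots> = z * Gamma z * Gamma (1 - z)" unfolding G ..
  also have "z * Gamma z * Gamma (1 - z) = z * (of_real pi / sin (of_real pi * z))"
    unfolding mult.assoc Gamma_reflection_complex ..
  also have "of_real pi * z = \<i> * of_real (pi * t)" by (simp add: z_def)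
  also have "sin (\<i> * of_real (pi * t)) = \<i> * of_real (sinh (pi * t))"
    by (simp add: sin_i_times sinh_field_def exp_minus flip: exp_of_real)
  finally have "complex_of_real ((norm (Gamma (1 + z)))\<^sup>2) = of_real (pi * t / sinh (pi * t))"
    by (simp add: z_def)
  then show ?thesis unfolding z_def of_real_eq_iff .
qed

lemma norm_rGamma_half_plus_imaginary:
  "(norm (rGamma (1 / 2 + \<i> * of_real y)))\<^sup>2 = cosh (pi * y) / pi"
proof -
  define z where "z = 1 / 2 + \<i> * complex_of_real y"
  have "cnj z = 1 - z" by (simp add: z_def complex_eq_iff)
  then have "of_real ((norm (rGamma z))\<^sup>2) = rGamma z * rGamma (1 - z)"
    unfolding complex_norm_square cnj_rGamma by simp
  also have "\<dots> = sin (of_real pi * z) / of_real pi" by (rule rGamma_reflection_complex)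
  also have "of_real pi * z = of_real pi / 2 + \<i> * of_real (pi * y)" by (simp add: z_def algebra_simps)
  also have "sin \<dots> = cos (\<i> * of_real (pi * y))" by (simp add: sin_add)
  also have "\<dots> = of_real (cosh (pi * y))"
    by (simp add: cos_i_times cosh_field_def exp_minus flip: exp_of_real)
  finally have "complex_of_real ((norm (rGamma z))\<^sup>2) = of_real (cosh (pi * y) / pi)" by simp
  then show ?thesis unfolding z_def of_real_eq_iff .
qed

lemma norm_rGamma_shift_le:
  fixes z :: complex
  assumes "Re z > 0"
  shows "norm (rGamma (z + of_nat n)) \<le> norm (rGamma z) / norm z ^ n"
proof -
  have z: "norm z > 0" using assms by auto
  have "norm z ^ n * norm (rGamma (z + of_nat n)) \<le> norm (pochhammer z n) * norm (rGamma (z + of_nat n))"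
    using assms by (intro mult_right_mono norm_pochhammer_ge_power) auto
  also have "\<dots> = norm (rGamma z)" by (simp add: pochhammer_rGamma[of z n] norm_mult)
  finally show ?thesis using z by (simp add: field_simps)
qed

text \<open>
  Up to a constant, the left-hand side is \<open>|lam|\<close> times the modulus of the Harish-Chandra c-function.
  By the reflection formula its square is \<open>coth (pi lam / 2)\<close> times a rational function of \<open>lam\<close>,
  and \<open>y coth (pi y) \<le> y + 1\<close> shows that in the square the hyperbolic cotangent costs only one
  power of \<open>|z|\<close> out of the fourteen that come from the shifts by 5 and 2.
\<close>

lemma norm_c_function_le:
  assumes "lam \<noteq> 0"
  defines "z \<equiv> 1 / 2 + \<i> * of_real (lam / 2)"
  shows "norm (Gamma (1 + \<i> * of_real lam) * rGamma (z + 5) * rGamma (z + 2)) \<le> norm z powr (- 13 / 2)"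
proof (rule power2_le_imp_le)
  define y where "y = \<bar>lam\<bar> / 2"
  have y: "y > 0" using assms by (simp add: y_def)
  have Re_z: "Re z = 1 / 2" and Im_z: "Im z = lam / 2" by (simp_all add: z_def)
  have z: "norm z \<ge> 1 / 2" "norm z \<ge> y"
    using abs_Re_le_cmod[of z] abs_Im_le_cmod[of z] by (simp_all add: Re_z Im_z y_def)
  then have z0: "norm z > 0" by linarith
  have G: "(norm (Gamma (1 + \<i> * of_real lam)))\<^sup>2 = pi * (2 * y) / sinh (pi * (2 * y))"
    using norm_Gamma_1_plus_imaginary[OF assms(1)] by (cases "lam \<ge> 0") (simp_all add: y_def)
  have R: "(norm (rGamma z))\<^sup>2 = cosh (pi * y) / pi"
    using norm_rGamma_half_plus_imaginary[of "lam / 2"] by (cases "lam \<ge> 0") (simp_all add: z_def y_def)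
  have "norm (rGamma (z + 5)) * norm (rGamma (z + 2)) \<le> (norm (rGamma z) / norm z ^ 5) * (norm (rGamma z) / norm z ^ 2)"
    using norm_rGamma_shift_le[of z 5] norm_rGamma_shift_le[of z 2] Re_z by (intro mult_mono) auto
  also have "\<dots> = cosh (pi * y) / pi / norm z ^ 7"
  proof -
    have "norm z ^ 7 = norm z ^ 5 * norm z ^ 2" using power_add[of "norm z" 5 2] by simp
    then show ?thesis unfolding R[symmetric] by (simp add: power2_eq_square)
  qed
  finally have "(norm (rGamma (z + 5)) * norm (rGamma (z + 2)))\<^sup>2 \<le> (cosh (pi * y) / pi / norm z ^ 7)\<^sup>2"
    by (intro power_mono) auto
  then have "(norm (Gamma (1 + \<i> * of_real lam) * rGamma (z + 5) * rGamma (z + 2)))\<^sup>2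
      \<le> pi * (2 * y) / sinh (pi * (2 * y)) * (cosh (pi * y) / pi / norm z ^ 7)\<^sup>2"
    unfolding norm_mult power_mult_distrib G[symmetric] mult.assoc by (intro mult_left_mono) auto
  also have "\<dots> = y * cosh (pi * y) / sinh (pi * y) / pi / norm z ^ 14"
  proof -
    have "sinh (pi * (2 * y)) = 2 * sinh (pi * y) * cosh (pi * y)"
      using sinh_double[of "pi * y"] by (simp add: mult_ac)
    moreover have "sinh (pi * y) > 0" "cosh (pi * y) > 0" using y by (auto simp: cosh_real_pos)
    moreover have "norm z ^ 14 = norm z ^ 7 * norm z ^ 7"
      using power_add[of "norm z" 7 7] by simp
    ultimately show ?thesis using z0 by (simp add: divide_simps power2_eq_square)
  qed
  also have "\<dots> \<le> (3 * norm z) / 3 / norm z ^ 14"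
  proof (intro divide_right_mono frac_le)
    have sinh_bounds: "x / 2 \<le> sinh x" "cosh x \<le> sinh x + 1" if "x \<ge> 0" for x :: real
    proof -
      have e: "exp (- x) \<le> 1" using that by simp
      then have "x \<le> exp x - exp (- x)" using exp_ge_add_one_self[of x] by linarith
      then show "x / 2 \<le> sinh x" unfolding sinh_field_def by (rule divide_right_mono) simp
      show "cosh x \<le> sinh x + 1" using e cosh_minus_sinh[of x] by linarith
    qed
    have half: "pi * y / 2 \<le> sinh (pi * y)" and "cosh (pi * y) \<le> sinh (pi * y) + 1"
      using sinh_bounds[of "pi * y"] y by simp_all
    moreover have "y \<le> sinh (pi * y)"
    proof -
      have "2 * y \<le> pi * y" using y pi_gt3 by (intro mult_right_mono) auto
      then show ?thesis using half by linarith
    qed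
    ultimately have "y * cosh (pi * y) \<le> y * sinh (pi * y) + sinh (pi * y)"
      using y mult_left_mono[of "cosh (pi * y)" "sinh (pi * y) + 1" y] by (simp add: distrib_left)
    then have "y * cosh (pi * y) / sinh (pi * y) \<le> y + 1"
      using y by (simp add: field_simps)
    also have "\<dots> \<le> 3 * norm z" using z by simp
    finally show "y * cosh (pi * y) / sinh (pi * y) \<le> 3 * norm z" .
  qed (use pi_gt3 in auto)
  also have "\<dots> = (norm z powr (- 13 / 2))\<^sup>2"
  proof -
    have "(norm z powr (- 13 / 2))\<^sup>2 = norm z powr (- 13)"
      unfolding power2_eq_square powr_add[symmetric] by simp
    also have "\<dots> = 1 / norm z ^ 13" using z0 by (simp add: powr_minus_divide)
    finally have "(norm z powr (- 13 / 2))\<^sup>2 = 1 / norm z ^ 13" .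
    moreover have "norm z ^ 14 = norm z * norm z ^ 13" using power_Suc[of "norm z" 13] by simp
    ultimately show ?thesis using z0 by simp
  qed
  finally show "(norm (Gamma (1 + \<i> * of_real lam) * rGamma (z + 5) * rGamma (z + 2)))\<^sup>2 \<le> (norm z powr (- 13 / 2))\<^sup>2" .
qed simp

section \<open>The spherical functions\<close>

text \<open>
  This is why the final bound is independent of \<open>l\<close> and \<open>m\<close>: the Pochhammer prefactor of the
  spherical function shifts the arguments of the Gamma factors back to those of the case \<open>l = m = 0\<close>.
\<close>

lemma Gamma_pochhammer_quotient:
  fixes s s' c :: complex
  assumes "c \<notin> \<int>\<^sub>\<le>\<^sub>0"
  shows "pochhammer s p * pochhammer s' q / pochhammer c n * (Gamma (c + of_nat n) * G * rGamma (s + of_nat p) * rGamma (s' + of_nat q))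
    = Gamma c * (G * rGamma s * rGamma s')"
proof -
  have "pochhammer c n \<noteq> 0" using assms by (auto simp: pochhammer_eq_0_iff)
  moreover have "Gamma (c + of_nat n) = pochhammer c n * Gamma c"
    using assms by (simp add: pochhammer_Gamma Gamma_eq_zero_iff)
  ultimately show ?thesis
    by (simp add: pochhammer_rGamma[of s p] pochhammer_rGamma[of s' q] mult_ac)
qed

text \<open>
  The two regimes meet at \<open>r = 1 / (2 |s|)\<close> with \<open>s = (i lam + rho) / 2\<close>. Below it the series estimate
  gives an absolute constant. Above it the uniform bound is divided by \<open>r powr (15/2)\<close>, that is,
  multiplied by at most a constant times \<open>|z| powr (15/2)\<close> with \<open>z = s - 5\<close>; against the decay
  \<open>|z| powr (-13/2)\<close> of the c-function one power of \<open>|z|\<close> remains, and together with the factor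
  \<open>1 + sqrt 2 / |lam|\<close> this is of the size \<open>1 + |lam| + 1 / |lam|\<close>. Membership in \<^const>\<open>K0_hat\<close> enters as
  \<open>l = m + 2 q\<close>.
\<close>

lemma norm_Phi_le:
  fixes lam r :: real and m q :: nat
  defines "l \<equiv> m + 2 * q"
  assumes lam: "lam \<noteq> 0" and r: "0 \<le> r" "r < 1"
  shows "norm (Phi (of_real lam) l m r)
    \<le> (2 + 4 * fact 7 * 22 powr (15 / 2)) * (1 + \<bar>lam\<bar> + 1 / \<bar>lam\<bar>) * (1 - r\<^sup>2) powr (rho / 2)"
proof -
  define s where "s = (\<i> * complex_of_real lam + of_real rho) / 2"
  define z where "z = 1 / 2 + \<i> * complex_of_real (lam / 2)"
  have s_z: "s = z + 5" "s - 3 = z + 2" by (simp_all add: s_def z_def rho_def field_simps)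
  define p where "p = m + q"
  have l: "l = p + q" by (simp add: l_def p_def)
  define C where "C = pochhammer s p * pochhammer (s - 3) q / pochhammer 8 l"
  define H where "H = hypergeo_2F1 (s + of_nat p) (s - 3 + of_nat q) (of_nat l + 8) (of_real (r\<^sup>2))"
  have args: "(\<i> * of_real lam + of_real rho + of_nat l + of_nat m) / 2 = s + of_nat p"
    "(\<i> * of_real lam + of_real rho + of_nat l - of_nat m) / 2 - 3 = s - 3 + of_nat q"
    "(m + l) div 2 = p" "(l - m) div 2 = q"
    by (simp_all add: s_def p_def l_def field_simps)
  have r2: "r\<^sup>2 < 1" using r by (simp add: abs_square_less_1)
  have Re_s: "Re s = 11 / 2" by (simp add: s_def rho_def)
  have "norm (of_real (1 - r\<^sup>2) powr s) = (1 - r\<^sup>2) powr (rho / 2)"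
    using norm_powr_real_powr[of "of_real (1 - r\<^sup>2)" s] r2 Re_s by (simp add: rho_def del: of_real_diff)
  then have Phi: "norm (Phi (of_real lam) l m r) = norm C * r ^ l * norm H * (1 - r\<^sup>2) powr (rho / 2)"
    unfolding Phi_def args s_def[symmetric] using r
    by (simp add: C_def H_def norm_mult norm_divide norm_power mult_ac del: of_real_diff)
  define K :: real where "K = 4 * fact 7 * 22 powr (15 / 2)"
  have K: "K \<ge> 0" by (simp add: K_def)
  have "norm C * r ^ l * norm H \<le> (2 + K) * (1 + \<bar>lam\<bar> + 1 / \<bar>lam\<bar>)"
  proof (cases "norm s * r \<le> 1 / 2")
    case True
    have N: "norm s \<ge> 1" using complex_Re_le_cmod[of s] Re_s by linarith
    have "norm (s - 3) \<le> norm s" using Re_s by (simp add: cmod_def)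
    then have "norm C * r ^ l * norm H \<le> 4 / 3"
      using hypergeo_small_bound[of s "norm s" "s - 3" 8 r p q] N True r
      by (simp add: C_def H_def l)
    also have "\<dots> \<le> 2 * 1" by simp
    also have "\<dots> \<le> (2 + K) * (1 + \<bar>lam\<bar> + 1 / \<bar>lam\<bar>)" using K by (intro mult_mono) auto
    finally show ?thesis .
  next
    case False
    then have r0: "r > 0" using r by (cases "r = 0") auto
    define G where "G = norm (Gamma (1 + \<i> * of_real lam) * rGamma (z + 5) * rGamma (z + 2))"
    have "Re z = 1 / 2" by (simp add: z_def)
    then have half: "1 / 2 \<le> norm z" using complex_Re_le_cmod[of z] by simp
    then have z0: "norm z > 0" by linarith
    have "norm z \<le> norm (1 / 2 :: complex) + norm (\<i> * complex_of_real (lam / 2))"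
      unfolding z_def by (rule norm_triangle_ineq)
    also have "\<dots> = (1 + \<bar>lam\<bar>) / 2" by (simp add: norm_mult add_divide_distrib)
    finally have z1: "norm z \<le> (1 + \<bar>lam\<bar>) / 2" .
    have "norm s \<le> 11 * norm z" using half norm_triangle_ineq[of z 5] by (simp add: s_z)
    then have "norm s * r \<le> 11 * norm z * r" using r by (intro mult_right_mono)
    then have "1 / 2 \<le> 11 * norm z * r" using False by linarith
    then have inv: "1 / r \<le> 22 * norm z" using r0 by (simp add: field_simps)
    have "r powr (real l + 15 / 2) * norm H
        \<le> (1 + sqrt 2 / \<bar>lam\<bar>) * (2 * norm (Gamma (of_nat l + 8) * Gamma (1 + \<i> * of_real lam)
              * rGamma (s + of_nat p) * rGamma (s - 3 + of_nat q)))"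
    proof -
      have ha: "(complex_of_real (real l + 8 + (real m + 3)) + \<i> * of_real lam) / 2 = s + of_nat p"
        and hb: "(complex_of_real (real l + 8 - (real m + 3)) + \<i> * of_real lam) / 2 = s - 3 + of_nat q"
        by (simp_all add: s_def rho_def p_def l_def field_simps)
      have hc: "complex_of_real (real l + 8) = of_nat l + 8" and he: "real l + 8 - 1 / 2 = real l + 15 / 2"
        by simp_all
      note bound = hypergeo_uniform_bound[OF lam, of "real m + 3" "real l + 8" r, unfolded ha hb hc he]
      show ?thesis
        unfolding H_def hypergeo_2F1_def by (rule bound) (use r0 r in \<open>auto simp: l_def\<close>)
    qed
    then have "norm C * (r powr (real l + 15 / 2) * norm H)
        \<le> norm C * ((1 + sqrt 2 / \<bar>lam\<bar>) * (2 * norm (Gamma (of_nat l + 8) * Gamma (1 + \<i> * of_real lam)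
              * rGamma (s + of_nat p) * rGamma (s - 3 + of_nat q))))"
      by (rule mult_left_mono) simp
    also have "\<dots> = (1 + sqrt 2 / \<bar>lam\<bar>) * (2 * norm (C * (Gamma (8 + of_nat l) * Gamma (1 + \<i> * of_real lam)
              * rGamma (s + of_nat p) * rGamma (s - 3 + of_nat q))))"
      unfolding norm_mult add.commute[of "8 :: complex"] by (simp only: mult_ac)
    also have "\<dots> = (1 + sqrt 2 / \<bar>lam\<bar>) * (2 * fact 7 * G)"
    proof -
      have "Gamma (8 :: complex) = fact 7" using Gamma_fact[of 7, where 'a = complex] by simp
      then show ?thesis unfolding C_def
        by (subst Gamma_pochhammer_quotient) (simp_all add: G_def norm_mult s_z add.commute)
    qed
    finally have main: "norm C * (r powr (real l + 15 / 2) * norm H) \<le> (1 + sqrt 2 / \<bar>lam\<bar>) * (2 * fact 7 * G)" .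
    have "norm C * r ^ l * norm H = norm C * (r powr (real l + 15 / 2) * norm H) * (1 / r) powr (15 / 2)"
      using r0 by (simp add: powr_add powr_realpow powr_divide)
    also have "\<dots> \<le> ((1 + sqrt 2 / \<bar>lam\<bar>) * (2 * fact 7 * norm z powr (- 13 / 2))) * (22 * norm z) powr (15 / 2)"
    proof (rule mult_mono)
      have "G \<le> norm z powr (- 13 / 2)" unfolding G_def z_def by (rule norm_c_function_le[OF lam])
      then have "(1 + sqrt 2 / \<bar>lam\<bar>) * (2 * fact 7 * G) \<le> (1 + sqrt 2 / \<bar>lam\<bar>) * (2 * fact 7 * norm z powr (- 13 / 2))"
        by (intro mult_left_mono) auto
      then show "norm C * (r powr (real l + 15 / 2) * norm H) \<le> (1 + sqrt 2 / \<bar>lam\<bar>) * (2 * fact 7 * norm z powr (- 13 / 2))"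
        using main by linarith
      show "(1 / r) powr (15 / 2) \<le> (22 * norm z) powr (15 / 2)"
        using inv r0 by (intro powr_mono2) auto
    qed auto
    also have "\<dots> = K / 2 * ((1 + sqrt 2 / \<bar>lam\<bar>) * norm z)"
    proof -
      have "norm z powr (- 13 / 2) * (22 * norm z) powr (15 / 2) = 22 powr (15 / 2) * norm z"
        using z0 by (simp add: powr_mult mult.left_commute powr_add[symmetric])
      then show ?thesis unfolding K_def by (simp add: mult_ac)
    qed
    also have "\<dots> \<le> K / 2 * (2 * (1 + \<bar>lam\<bar> + 1 / \<bar>lam\<bar>))"
    proof (rule mult_left_mono)
      have "sqrt 2 \<le> 2" by (rule real_le_lsqrt) auto
      then have "(1 + sqrt 2 / \<bar>lam\<bar>) * norm z \<le> (1 + 2 / \<bar>lam\<bar>) * ((1 + \<bar>lam\<bar>) / 2)"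
        using z1 by (intro mult_mono add_mono divide_right_mono) auto
      also have "\<dots> = 3 / 2 + \<bar>lam\<bar> / 2 + 1 / \<bar>lam\<bar>" using lam by (simp add: field_simps)
      also have "\<dots> \<le> 2 * (1 + \<bar>lam\<bar> + 1 / \<bar>lam\<bar>)"
      proof -
        have "3 / 2 + x / 2 + y \<le> 2 * (1 + x + y)" if "x \<ge> 0" "y \<ge> 0" for x y :: real
          using that by (simp add: field_simps)
        from this[of "\<bar>lam\<bar>" "1 / \<bar>lam\<bar>"] show ?thesis by simp
      qed
      finally show "(1 + sqrt 2 / \<bar>lam\<bar>) * norm z \<le> 2 * (1 + \<bar>lam\<bar> + 1 / \<bar>lam\<bar>)" .
    qed (use K in simp)
    also have "\<dots> = K * (1 + \<bar>lam\<bar> + 1 / \<bar>lam\<bar>)" by simp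
    also have "\<dots> \<le> (2 + K) * (1 + \<bar>lam\<bar> + 1 / \<bar>lam\<bar>)"
      by (rule mult_right_mono) auto
    finally show ?thesis .
  qed
  then show ?thesis unfolding Phi K_def by (intro mult_right_mono) auto
qed

theorem corollary1p1:
  shows "\<exists>c::real. c > 0 \<and>
    (\<forall>lam::real. \<forall>r::real. lam \<noteq> 0 \<longrightarrow> 0 \<le> r \<longrightarrow> r < 1 \<longrightarrow>
      (SUP (l, m) \<in> K0_hat. ereal (cmod (Phi (of_real lam) l m r)))
        \<le> ereal (c * (1 + \<bar>lam\<bar> + 1 / \<bar>lam\<bar>) * (1 - r\<^sup>2) powr (rho / 2)))"
proof (intro exI conjI allI impI)
  show "(2 + 4 * fact 7 * 22 powr (15 / 2) :: real) > 0" by (simp add: add_pos_nonneg)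
  fix lam r :: real
  assume *: "lam \<noteq> 0" "0 \<le> r" "r < 1"
  show "(SUP (l, m) \<in> K0_hat. ereal (cmod (Phi (of_real lam) l m r)))
        \<le> ereal ((2 + 4 * fact 7 * 22 powr (15 / 2)) * (1 + \<bar>lam\<bar> + 1 / \<bar>lam\<bar>) * (1 - r\<^sup>2) powr (rho / 2))"
  proof (rule SUP_least, clarify)
    fix l m assume "(l, m) \<in> K0_hat"
    then have "m \<le> l" "even (l - m)" by (auto simp: K0_hat_def)
    then obtain q where "l = m + 2 * q" by (metis evenE le_add_diff_inverse)
    then show "ereal (cmod (Phi (of_real lam) l m r))
        \<le> ereal ((2 + 4 * fact 7 * 22 powr (15 / 2)) * (1 + \<bar>lam\<bar> + 1 / \<bar>lam\<bar>) * (1 - r\<^sup>2) powr (rho / 2))"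
      using norm_Phi_le[OF *] by (simp only: ereal_less_eq)
  qed
qed

end
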